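(* Let $n\ge2$ and let $T=\big((T_{i,j})\big)_{i,j=1}^{n},\ \tilde T=\big((\tilde T_{i,j})\big)_{i,j=1}^{n}\in\mathcal{F}_n(\mathcal{A})$, where for each $1\le i\le n$ the operators $T_{i,i}$ and $\tilde T_{i,i}$ are strongly irreducible and $\{T_{i,i}\}'$ and $\{\tilde T_{i,i}\}'$ are semi-simple commutative Banach algebras. Suppose that $\tilde T$ satisfies Property (H), that is, for each $1\le i\le n-1$ the operators $\tilde T_{i,i}$ and $\tilde T_{i+1,i+1}$ satisfy Property (H). If $T$ is quasi-similar to $\tilde T$, then $T$ is strongly irreducible.
   Context: All Hilbert spaces are complex and separable. A bounded operator is quasi-affine if it is injective with dense range. $T\in\mathcal{B}(\mathcal{H})$ and $\tilde T\in\mathcal{B}(\tilde{\mathcal{H}})$ are quasi-similar if there are quasi-affine operators $X,Y$ with $XT=\tilde T X$ and $TY=Y\tilde T$. $T$ is strongly irreducible if it commutes with no nontrivial idempotent (i.e. no bounded idempotent other than $0$ and $I$). The commutant is $\{T\}'=\{A\in\mathcal{B}(\mathcal{H}):TA=AT\}$; it is semi-simple if its Jacobson radical is $\{0\}$. Two operators $T_1\in\mathcal{B}(\mathcal{H}_1),T_2\in\mathcal{B}(\mathcal{H}_2)$ satisfy Property (H) if: whenever $X:\mathcal{H}_2\to\mathcal{H}_1$ is a bounded operator with $T_1X=XT_2$ and $X=T_1Y-YT_2$ for some bounded $Y:\mathcal{H}_2\to\mathcal{H}_1$, then $X=0$. $\mathcal{A}$ denotes a class of bounded Hilbert space operators such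 that for any $T\in\mathcal{B}(\mathcal{H})$ and $\tilde T\in\mathcal{B}(\tilde{\mathcal{H}})$ in $\mathcal{A}$, every nonzero bounded operator $X:\tilde{\mathcal{H}}\to\mathcal{H}$ with $TX=X\tilde T$ has dense range. For $n\ge2$, $T\in\mathcal{B}(\mathcal{H})$ is in $\mathcal{F}_n(\mathcal{A})$ if: (1) $T=\big((T_{i,j})\big)_{i,j=1}^n$ is an $n\times n$ upper-triangular operator matrix with respect to a topological direct decomposition $\mathcal{H}=\mathcal{H}_1\oplus\cdots\oplus\mathcal{H}_n$ (so $T_{i,j}:\mathcal{H}_j\to\mathcal{H}_i$); (2) $T_{i,i}\in\mathcal{A}$ for $1\le i\le n$; (3) $T_{i,i+1}\neq0$ and $T_{i,i}T_{i,i+1}=T_{i,i+1}T_{i+1,i+1}$ for $1\le i\le n-1$. *)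

theory Defs
  imports "HOL-Analysis.Analysis" "HOL-Algebra.Ideal"
begin

section \<open>Complex Hilbert spaces\<close>

class complex_hilbert = banach +
  fixes scaleC :: "complex \<Rightarrow> 'a \<Rightarrow> 'a"
    and cinner :: "'a \<Rightarrow> 'a \<Rightarrow> complex"
  assumes scaleC_add_right: "scaleC c (x + y) = scaleC c x + scaleC c y"
    and scaleC_add_left: "scaleC (c + d) x = scaleC c x + scaleC d x"
    and scaleC_scaleC: "scaleC c (scaleC d x) = scaleC (c * d) x"
    and scaleR_scaleC: "scaleR r x = scaleC (complex_of_real r) x"
    and cinner_commute: "cinner x y = cnj (cinner y x)"
    and cinner_add_left: "cinner (x + y) z = cinner x z + cinner y z"
    and cinner_scaleC_left: "cinner (scaleC c x) y = c * cinner x y"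
    and cinner_norm: "cinner x x = complex_of_real ((norm x)\<^sup>2)"

lemma vector_space_scaleC:
  "vector_space (scaleC :: complex \<Rightarrow> 'a \<Rightarrow> 'a::complex_hilbert)"
proof
  show "scaleC 1 x = x" for x :: 'a
    by (metis of_real_1 scaleR_one scaleR_scaleC)
qed (simp_all add: scaleC_add_right scaleC_add_left scaleC_scaleC)

text \<open>
  The statement is about a class of operators living on many different Hilbert spaces. As HOL
  cannot quantify over types, a Hilbert space is a closed complex subspace of an ambient
  complex Hilbert space, which is an arbitrary type of the class above and need not be
  separable. Nothing is lost: any set of complex Hilbert spaces embeds isometrically, as mutually
  orthogonal closed subspaces, into its Hilbert direct sum. The product
  instance below does this for two spaces.
\<close>

instantiation complex :: complex_hilbert
begin
definition scaleC_complex :: "complex \<Rightarrow> complex \<Rightarrow> complex" where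
  "scaleC_complex c x = c * x"
definition cinner_complex :: "complex \<Rightarrow> complex \<Rightarrow> complex" where
  "cinner_complex x y = x * cnj y"
instance
proof
  show "cinner x x = complex_of_real ((norm x)\<^sup>2)" for x :: complex
    unfolding cinner_complex_def by (rule complex_norm_square [symmetric])
qed (simp_all add: scaleC_complex_def cinner_complex_def algebra_simps scaleR_conv_of_real)
end

instantiation prod :: (complex_hilbert, complex_hilbert) complex_hilbert
begin
definition scaleC_prod :: "complex \<Rightarrow> 'a \<times> 'b \<Rightarrow> 'a \<times> 'b" where
  "scaleC_prod c x = (scaleC c (fst x), scaleC c (snd x))"
definition cinner_prod :: "'a \<times> 'b \<Rightarrow> 'a \<times> 'b \<Rightarrow> complex" where
  "cinner_prod x y = cinner (fst x) (fst y) + cinner (snd x) (snd y)"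
instance
proof
  show "cinner x y = cnj (cinner y x)" for x y :: "'a \<times> 'b"
    unfolding cinner_prod_def
    by (metis cinner_commute complex_cnj_add)
  show "cinner x x = complex_of_real ((norm x)\<^sup>2)" for x :: "'a \<times> 'b"
    by (simp add: cinner_prod_def norm_prod_def cinner_norm)
qed (simp_all add: scaleC_prod_def cinner_prod_def prod_eq_iff scaleC_add_right
      scaleC_add_left scaleC_scaleC scaleR_scaleC cinner_add_left cinner_scaleC_left algebra_simps)
end

abbreviation csubspace :: "'a::complex_hilbert set \<Rightarrow> bool" where
  "csubspace \<equiv> module.subspace scaleC"

definition separable_hilbert :: "'a::complex_hilbert set \<Rightarrow> bool" where
  "separable_hilbert H \<longleftrightarrow> csubspace H \<and> closed H \<and> separable_space (top_of_set H)"


section \<open>Bounded operators between closed subspaces\<close>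

text \<open>
  An operator is only meaningful on its domain; as an element of
  \<open>H \<rightarrow>\<^sub>E K\<close> it is \<open>undefined\<close> elsewhere, so that equality of
  functions is equality of operators. Compositions, sums and constants are
  restricted accordingly.
\<close>

definition bounded_ops ::
    "'a::complex_hilbert set \<Rightarrow> 'b::complex_hilbert set \<Rightarrow> ('a \<Rightarrow> 'b) set" where
  "bounded_ops H K = {X \<in> H \<rightarrow>\<^sub>E K.
     (\<forall>x\<in>H. \<forall>y\<in>H. X (x + y) = X x + X y) \<and>
     (\<forall>c. \<forall>x\<in>H. X (scaleC c x) = scaleC c (X x)) \<and>
     (\<exists>B. \<forall>x\<in>H. norm (X x) \<le> B * norm x)}"

definition zero_op :: "'a set \<Rightarrow> 'a \<Rightarrow> 'b::complex_hilbert" where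
  "zero_op H = (\<lambda>x\<in>H. 0)"

definition id_op :: "'a set \<Rightarrow> 'a \<Rightarrow> 'a" where
  "id_op H = (\<lambda>x\<in>H. x)"

definition dense_range :: "'a set \<Rightarrow> 'b::complex_hilbert set \<Rightarrow> ('a \<Rightarrow> 'b) \<Rightarrow> bool" where
  "dense_range H K X \<longleftrightarrow> K \<subseteq> closure (X ` H)"

definition quasi_affine ::
    "'a::complex_hilbert set \<Rightarrow> 'b::complex_hilbert set \<Rightarrow> ('a \<Rightarrow> 'b) \<Rightarrow> bool" where
  "quasi_affine H K X \<longleftrightarrow> X \<in> bounded_ops H K \<and> inj_on X H \<and> dense_range H K X"

definition quasi_similar ::
    "'a::complex_hilbert set \<Rightarrow> ('a \<Rightarrow> 'a) \<Rightarrow> 'b::complex_hilbert set \<Rightarrow> ('b \<Rightarrow> 'b) \<Rightarrow> bool" where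
  "quasi_similar H T K S \<longleftrightarrow>
     (\<exists>X Y. quasi_affine H K X \<and> quasi_affine K H Y \<and>
        compose H X T = compose H S X \<and> compose K T Y = compose K Y S)"

definition strongly_irreducible :: "'a::complex_hilbert set \<Rightarrow> ('a \<Rightarrow> 'a) \<Rightarrow> bool" where
  "strongly_irreducible H T \<longleftrightarrow>
     (\<forall>P \<in> bounded_ops H H. compose H P P = P \<and> compose H T P = compose H P T \<longrightarrow>
        P = zero_op H \<or> P = id_op H)"

definition property_H ::
    "'a::complex_hilbert set \<Rightarrow> ('a \<Rightarrow> 'a) \<Rightarrow> 'b::complex_hilbert set \<Rightarrow> ('b \<Rightarrow> 'b) \<Rightarrow> bool" where
  "property_H H1 T1 H2 T2 \<longleftrightarrow>
     (\<forall>X \<in> bounded_ops H2 H1.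
        compose H2 T1 X = compose H2 X T2 \<and>
        (\<exists>Y \<in> bounded_ops H2 H1. X = (\<lambda>x\<in>H2. T1 (Y x) - Y (T2 x)))
        \<longrightarrow> X = zero_op H2)"


section \<open>The commutant and its Jacobson radical\<close>

definition commutant :: "'a::complex_hilbert set \<Rightarrow> ('a \<Rightarrow> 'a) \<Rightarrow> ('a \<Rightarrow> 'a) ring" where
  "commutant H T =
     \<lparr>carrier = {A \<in> bounded_ops H H. compose H T A = compose H A T},
      mult = compose H,
      one = id_op H,
      zero = zero_op H,
      add = (\<lambda>A B. \<lambda>x\<in>H. A x + B x)\<rparr>"

text \<open>
  The commutant is always a ring, so \<open>cring\<close> only adds commutativity.
\<close>

lemma ring_commutant:
  assumes H: "csubspace H" and T: "T \<in> bounded_ops H H"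
  shows "ring (commutant H T)"
proof -
  interpret vs: vector_space "scaleC :: complex \<Rightarrow> 'a \<Rightarrow> 'a" by (rule vector_space_scaleC)
  have H0: "0 \<in> H" and Ha: "\<And>x y. x \<in> H \<Longrightarrow> y \<in> H \<Longrightarrow> x + y \<in> H"
    and Hs: "\<And>c x. x \<in> H \<Longrightarrow> scaleC c x \<in> H"
    using H by (auto simp: vs.subspace_def)
  have Hn: "- x \<in> H" if "x \<in> H" for x
    using H that by (rule vs.subspace_neg)
  have m: "A x \<in> H" if "A \<in> bounded_ops H H" "x \<in> H" for A x
    using that by (auto simp: bounded_ops_def)
  have l: "A (x + y) = A x + A y" if "A \<in> bounded_ops H H" "x \<in> H" "y \<in> H" for A x y
    using that by (auto simp: bounded_ops_def)
  have s: "A (scaleC c x) = scaleC c (A x)" if "A \<in> bounded_ops H H" "x \<in> H" for A c x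
    using that by (auto simp: bounded_ops_def)
  have e: "A \<in> extensional H" if "A \<in> bounded_ops H H" for A
    using that by (auto simp: bounded_ops_def PiE_def)
  have z: "A 0 = 0" if "A \<in> bounded_ops H H" for A
    using l[OF that H0 H0] by simp
  have b: "\<exists>B\<ge>0. \<forall>x\<in>H. norm (A x) \<le> B * norm x" if A: "A \<in> bounded_ops H H" for A
  proof -
    obtain B where B: "\<forall>x\<in>H. norm (A x) \<le> B * norm x"
      using A by (auto simp: bounded_ops_def)
    have "norm (A x) \<le> \<bar>B\<bar> * norm x" if "x \<in> H" for x
      using B[rule_format, OF that] mult_right_mono[of B "\<bar>B\<bar>" "norm x"]
      by (meson abs_ge_self norm_ge_zero order_trans)
    then show ?thesis by (intro exI[of _ "\<bar>B\<bar>"]) simp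
  qed
  have opI: "A \<in> bounded_ops H H"
    if "A \<in> extensional H" "\<And>x. x \<in> H \<Longrightarrow> A x \<in> H"
      "\<And>x y. x \<in> H \<Longrightarrow> y \<in> H \<Longrightarrow> A (x + y) = A x + A y"
      "\<And>c x. x \<in> H \<Longrightarrow> A (scaleC c x) = scaleC c (A x)"
      "\<And>x. x \<in> H \<Longrightarrow> norm (A x) \<le> B * norm x" for A and B :: real
    using that by (auto simp: bounded_ops_def PiE_def intro!: exI[of _ B])
  have add: "(\<lambda>x\<in>H. A x + B x) \<in> bounded_ops H H"
    if A: "A \<in> bounded_ops H H" and B: "B \<in> bounded_ops H H" for A B
  proof -
    obtain a where a: "\<forall>x\<in>H. norm (A x) \<le> a * norm x" using b[OF A] by blast
    obtain c where c: "\<forall>x\<in>H. norm (B x) \<le> c * norm x" using b[OF B] by blast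
    have "norm (A x + B x) \<le> (a + c) * norm x" if "x \<in> H" for x
      using norm_triangle_ineq[of "A x" "B x"] a[rule_format, OF that] c[rule_format, OF that]
      by (simp add: algebra_simps)
    then show ?thesis
      by (intro opI[of _ "a + c"])
        (simp_all add: Ha Hs m[OF A] m[OF B] l[OF A] l[OF B] s[OF A] s[OF B] scaleC_add_right)
  qed
  have mult: "compose H A B \<in> bounded_ops H H"
    if A: "A \<in> bounded_ops H H" and B: "B \<in> bounded_ops H H" for A B
  proof -
    obtain a where a0: "a \<ge> 0" and a: "\<forall>x\<in>H. norm (A x) \<le> a * norm x" using b[OF A] by blast
    obtain c where c: "\<forall>x\<in>H. norm (B x) \<le> c * norm x" using b[OF B] by blast
    have "norm (A (B x)) \<le> (a * c) * norm x" if "x \<in> H" for x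
      using order_trans[OF a[rule_format, OF m[OF B that]] mult_left_mono[OF c[rule_format, OF that] a0]]
      by (simp add: mult.assoc)
    then show ?thesis
      by (intro opI[of _ "a * c"])
        (simp_all add: compose_def Ha Hs m[OF A] m[OF B] l[OF A] l[OF B] s[OF A] s[OF B])
  qed
  have one: "id_op H \<in> bounded_ops H H"
    by (rule opI[of _ 1]) (simp_all add: id_op_def Ha Hs)
  have zero: "zero_op H \<in> bounded_ops H H"
    by (rule opI[of _ 0]) (simp_all add: zero_op_def Ha Hs H0)
  have neg: "(\<lambda>x\<in>H. - A x) \<in> bounded_ops H H" if A: "A \<in> bounded_ops H H" for A
  proof -
    obtain a where a: "\<forall>x\<in>H. norm (A x) \<le> a * norm x" using b[OF A] by blast
    then show ?thesis
      by (intro opI[of _ a]) (simp_all add: Ha Hs Hn m[OF A] l[OF A] s[OF A])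
  qed
  have neg': "T (- x) = - T x" if "x \<in> H" for x
    using l[OF T that Hn[OF that]] z[OF T] by (simp add: add_eq_0_iff)
  have comm: "compose H T A = compose H A T \<longleftrightarrow> (\<forall>x\<in>H. T (A x) = A (T x))" for A
    by (auto simp: compose_def restrict_def fun_eq_iff)
  have C: "A \<in> carrier (commutant H T) \<longleftrightarrow> A \<in> bounded_ops H H \<and> (\<forall>x\<in>H. T (A x) = A (T x))"
    for A by (simp add: commutant_def comm)
  have eqI: "A = B" if "A \<in> extensional H" "B \<in> extensional H" "\<And>x. x \<in> H \<Longrightarrow> A x = B x" for A B
    using that by (rule extensionalityI)
  have plus: "A \<oplus>\<^bsub>commutant H T\<^esub> B = (\<lambda>x\<in>H. A x + B x)"
    and times: "A \<otimes>\<^bsub>commutant H T\<^esub> B = compose H A B"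
    and zer: "\<zero>\<^bsub>commutant H T\<^esub> = zero_op H" and on: "\<one>\<^bsub>commutant H T\<^esub> = id_op H"
    for A B by (simp_all add: commutant_def)
  note CD = C plus times zer on add mult zero one
  show ?thesis
  proof (rule ringI)
    show "abelian_group (commutant H T)"
    proof (rule abelian_groupI)
      fix A B assume "A \<in> carrier (commutant H T)" "B \<in> carrier (commutant H T)"
      then show "A \<oplus>\<^bsub>commutant H T\<^esub> B \<in> carrier (commutant H T)"
        by (simp add: CD l[OF T] m m[OF T])
    next
      show "\<zero>\<^bsub>commutant H T\<^esub> \<in> carrier (commutant H T)"
        using m[OF T] z[OF T] by (simp add: CD) (simp add: zero_op_def H0)
    next
      fix A B D
      assume "A \<in> carrier (commutant H T)" "B \<in> carrier (commutant H T)" "D \<in> carrier (commutant H T)"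
      show "A \<oplus>\<^bsub>commutant H T\<^esub> B \<oplus>\<^bsub>commutant H T\<^esub> D =
          A \<oplus>\<^bsub>commutant H T\<^esub> (B \<oplus>\<^bsub>commutant H T\<^esub> D)"
        by (rule eqI) (simp_all add: CD add.assoc)
    next
      fix A B assume "A \<in> carrier (commutant H T)" "B \<in> carrier (commutant H T)"
      show "A \<oplus>\<^bsub>commutant H T\<^esub> B = B \<oplus>\<^bsub>commutant H T\<^esub> A"
        by (rule eqI) (simp_all add: CD add.commute)
    next
      fix A assume "A \<in> carrier (commutant H T)"
      then show "\<zero>\<^bsub>commutant H T\<^esub> \<oplus>\<^bsub>commutant H T\<^esub> A = A"
        by (intro eqI) (simp_all add: CD e zero_op_def)
    next
      fix A assume A: "A \<in> carrier (commutant H T)"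
      then have "(\<lambda>x\<in>H. - A x) \<in> carrier (commutant H T)"
        by (simp add: C neg m m[OF T] neg')
      moreover have "(\<lambda>x\<in>H. - A x) \<oplus>\<^bsub>commutant H T\<^esub> A = \<zero>\<^bsub>commutant H T\<^esub>"
        by (rule eqI) (simp_all add: CD zero_op_def)
      ultimately show "\<exists>B\<in>carrier (commutant H T). B \<oplus>\<^bsub>commutant H T\<^esub> A = \<zero>\<^bsub>commutant H T\<^esub>"
        by blast
    qed
    show "Group.monoid (commutant H T)"
    proof (rule monoidI)
      fix A B assume "A \<in> carrier (commutant H T)" "B \<in> carrier (commutant H T)"
      then show "A \<otimes>\<^bsub>commutant H T\<^esub> B \<in> carrier (commutant H T)"
        by (simp add: CD) (simp add: compose_def m m[OF T])
    next
      show "\<one>\<^bsub>commutant H T\<^esub> \<in> carrier (commutant H T)"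
        by (simp add: CD) (simp add: id_op_def m[OF T])
    next
      fix A B D
      assume "A \<in> carrier (commutant H T)" "B \<in> carrier (commutant H T)" "D \<in> carrier (commutant H T)"
      then show "A \<otimes>\<^bsub>commutant H T\<^esub> B \<otimes>\<^bsub>commutant H T\<^esub> D =
          A \<otimes>\<^bsub>commutant H T\<^esub> (B \<otimes>\<^bsub>commutant H T\<^esub> D)"
        by (intro eqI) (simp_all add: CD compose_def m)
    next
      fix A assume "A \<in> carrier (commutant H T)"
      then show "\<one>\<^bsub>commutant H T\<^esub> \<otimes>\<^bsub>commutant H T\<^esub> A = A"
        and "A \<otimes>\<^bsub>commutant H T\<^esub> \<one>\<^bsub>commutant H T\<^esub> = A"
        by (intro eqI; simp add: CD compose_def id_op_def m e)+
    qed
  next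
    fix A B D
    assume "A \<in> carrier (commutant H T)" "B \<in> carrier (commutant H T)" "D \<in> carrier (commutant H T)"
    then show "(A \<oplus>\<^bsub>commutant H T\<^esub> B) \<otimes>\<^bsub>commutant H T\<^esub> D =
        A \<otimes>\<^bsub>commutant H T\<^esub> D \<oplus>\<^bsub>commutant H T\<^esub> B \<otimes>\<^bsub>commutant H T\<^esub> D"
      and "D \<otimes>\<^bsub>commutant H T\<^esub> (A \<oplus>\<^bsub>commutant H T\<^esub> B) =
        D \<otimes>\<^bsub>commutant H T\<^esub> A \<oplus>\<^bsub>commutant H T\<^esub> D \<otimes>\<^bsub>commutant H T\<^esub> B"
      by (intro eqI; simp add: CD compose_def m l)+
  qed
qed

definition left_ideal :: "'a set \<Rightarrow> ('a, 'b) ring_scheme \<Rightarrow> bool" where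
  "left_ideal I R \<longleftrightarrow> additive_subgroup I R \<and>
     (\<forall>r \<in> carrier R. \<forall>a \<in> I. r \<otimes>\<^bsub>R\<^esub> a \<in> I)"

definition maximal_left_ideal :: "'a set \<Rightarrow> ('a, 'b) ring_scheme \<Rightarrow> bool" where
  "maximal_left_ideal I R \<longleftrightarrow> left_ideal I R \<and> I \<noteq> carrier R \<and>
     (\<forall>J. left_ideal J R \<and> I \<subseteq> J \<longrightarrow> J = I \<or> J = carrier R)"

text \<open>
  The commutant has a unit, so its left ideals are automatically complex subspaces and the
  radical of the ring is the radical of the algebra. Intersecting with the carrier
  settles the zero ring, which has no maximal left ideal.
\<close>

definition jacobson_radical :: "('a, 'b) ring_scheme \<Rightarrow> 'a set" where
  "jacobson_radical R = carrier R \<inter> \<Inter>{I. maximal_left_ideal I R}"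

definition semisimple_ring :: "('a, 'b) ring_scheme \<Rightarrow> bool" where
  "semisimple_ring R \<longleftrightarrow> jacobson_radical R = {\<zero>\<^bsub>R\<^esub>}"


section \<open>Operator matrices and the classes of flag operators\<close>

text \<open>The summands of a decomposition are indexed by \<open>1, \<dots>, n\<close>.\<close>

definition component :: "nat \<Rightarrow> (nat \<Rightarrow> 'a::complex_hilbert set) \<Rightarrow> nat \<Rightarrow> 'a \<Rightarrow> 'a" where
  "component n M i x = (THE f. f \<in> Pi\<^sub>E {1..n} M \<and> x = (\<Sum>k\<in>{1..n}. f k)) i"

definition topological_direct_sum ::
    "'a::complex_hilbert set \<Rightarrow> nat \<Rightarrow> (nat \<Rightarrow> 'a set) \<Rightarrow> bool" where
  "topological_direct_sum H n M \<longleftrightarrow>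
     (\<forall>i\<in>{1..n}. csubspace (M i) \<and> closed (M i) \<and> M i \<subseteq> H) \<and>
     (\<forall>x\<in>H. \<exists>!f. f \<in> Pi\<^sub>E {1..n} M \<and> x = (\<Sum>k\<in>{1..n}. f k)) \<and>
     (\<forall>i\<in>{1..n}. restrict (component n M i) H \<in> bounded_ops H (M i))"

definition op_entry ::
    "nat \<Rightarrow> (nat \<Rightarrow> 'a::complex_hilbert set) \<Rightarrow> ('a \<Rightarrow> 'a) \<Rightarrow> nat \<Rightarrow> nat \<Rightarrow> 'a \<Rightarrow> 'a" where
  "op_entry n M T i j = (\<lambda>x \<in> M j. component n M i (T x))"

text \<open>
  A class of operators is a set of pairs, each consisting of a Hilbert space and an operator on it.
\<close>

definition dense_range_class :: "('a::complex_hilbert set \<times> ('a \<Rightarrow> 'a)) set \<Rightarrow> bool" where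
  "dense_range_class \<A> \<longleftrightarrow>
     (\<forall>(H, T)\<in>\<A>. separable_hilbert H \<and> T \<in> bounded_ops H H) \<and>
     (\<forall>(H, T)\<in>\<A>. \<forall>(K, S)\<in>\<A>. \<forall>X \<in> bounded_ops K H.
        X \<noteq> zero_op K \<and> compose K T X = compose K X S \<longrightarrow> dense_range K H X)"

text \<open>
  \<open>flag_class n \<A> H M T\<close> says that \<open>T\<close>, as an operator matrix with
  respect to the decomposition \<open>M\<close> of \<open>H\<close>, belongs to the
  class written \<open>\<F>\<^sub>n(\<A>)\<close>.
\<close>

definition flag_class ::
    "nat \<Rightarrow> ('a::complex_hilbert set \<times> ('a \<Rightarrow> 'a)) set \<Rightarrow>
      'a set \<Rightarrow> (nat \<Rightarrow> 'a set) \<Rightarrow> ('a \<Rightarrow> 'a) \<Rightarrow> bool" where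
  "flag_class n \<A> H M T \<longleftrightarrow>
     separable_hilbert H \<and> T \<in> bounded_ops H H \<and> topological_direct_sum H n M \<and>
     (\<forall>i\<in>{1..n}. \<forall>j\<in>{1..n}. j < i \<longrightarrow> op_entry n M T i j = zero_op (M j)) \<and>
     (\<forall>i\<in>{1..n}. (M i, op_entry n M T i i) \<in> \<A>) \<and>
     (\<forall>i\<in>{1..n-1}. op_entry n M T i (i+1) \<noteq> zero_op (M (i+1)) \<and>
        compose (M (i+1)) (op_entry n M T i i) (op_entry n M T i (i+1)) =
        compose (M (i+1)) (op_entry n M T i (i+1)) (op_entry n M T (i+1) (i+1)))"

end

theory Submission
  imports Defs
begin

text \<open>
  Write \<open>R\<^sub>i\<close> and \<open>S\<^sub>i\<close> for the diagonal entries of two flags \<open>T\<close> and \<open>S\<close>, and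
  \<open>A \<leadsto> B\<close> (below: \<open>intertwined\<close>) if some nonzero operator intertwines \<open>A\<close> with \<open>B\<close>. Within
  the class nonzero intertwiners have dense range, so a composition of them is again nonzero: the
  relation is transitive. The superdiagonal entries give \<open>R\<^sub>j \<leadsto> R\<^sub>i\<close> for \<open>i \<le> j\<close>, and likewise for
  \<open>S\<close>. Moreover Property (H) can be moved along the relation: an operator that violates it for
  \<open>(L, K)\<close> can be composed with \<open>L \<leadsto> G\<close> on the left and with \<open>G' \<leadsto> K\<close> on the right, which gives a
  nonzero operator that violates it for \<open>(G, G')\<close> (\<open>property_H_transfer\<close>).

  Let \<open>X\<close> intertwine two flags and suppose that its rows below row \<open>i\<close> are upper triangular.
  Let \<open>j < i\<close> be the first column where row \<open>i\<close> does not vanish. Comparing the entries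
  \<open>(i, j)\<close> and \<open>(i, j+1)\<close> of the intertwining relation shows that \<open>X\<^sub>i\<^sub>j\<close> intertwines the diagonal
  entries and that \<open>X\<^sub>i\<^sub>j T\<^sub>j\<^sub>,\<^sub>j\<^sub>+\<^sub>1\<close> has the form \<open>S\<^sub>i Z - Z R\<^sub>j\<^sub>+\<^sub>1\<close> with \<open>Z = X\<^sub>i\<^sub>,\<^sub>j\<^sub>+\<^sub>1\<close>. Property (H)
  for \<open>S\<^sub>i\<close> and \<open>R\<^sub>j\<^sub>+\<^sub>1\<close> kills this product, hence \<open>X\<^sub>i\<^sub>j\<close>, because \<open>T\<^sub>j\<^sub>,\<^sub>j\<^sub>+\<^sub>1\<close> has dense range
  (\<open>upper_row_step\<close>). In the same way the entry \<open>(i, i+1)\<close> yields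
  \<open>X\<^sub>i\<^sub>i T\<^sub>i\<^sub>,\<^sub>i\<^sub>+\<^sub>1 = S\<^sub>i\<^sub>,\<^sub>i\<^sub>+\<^sub>1 X\<^sub>i\<^sub>+\<^sub>1\<^sub>,\<^sub>i\<^sub>+\<^sub>1\<close> (\<open>diagonal_relation\<close>).

  It follows that a flag with Property (H) is strongly irreducible if its diagonal entries are
  (\<open>strongly_irreducible_flag\<close>). An idempotent \<open>P\<close> in its commutant is upper triangular, each
  \<open>P\<^sub>i\<^sub>i\<close> is an idempotent in the commutant of the \<open>i\<close>-th diagonal entry and so is \<open>0\<close> or the identity,
  and the diagonal relation forces the same choice for all \<open>i\<close>. If all are \<open>0\<close>, then \<open>P\<close> is
  nilpotent and idempotent, so \<open>P = 0\<close>; otherwise this applies to the complementary idempotent.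

  It remains to carry Property (H) from one flag to the other (\<open>flag_H_left\<close>), for which
  \<open>R\<^sub>i \<leadsto> S\<^sub>i\<close> and \<open>S\<^sub>i \<leadsto> R\<^sub>i\<close> for all \<open>i\<close> are enough. Let \<open>X\<close> and \<open>Y\<close> be the two quasi-affinities. The
  product \<open>X Y\<close> lies in the commutant of the flag with Property (H) and has dense range; its last
  diagonal entry is therefore nonzero, and by the diagonal relation all of them are. Going up from
  the last row, a nonzero \<open>(X Y)\<^sub>i\<^sub>i\<close> exhibits a nonzero entry in row \<open>i\<close> of \<open>X\<close>, hence
  \<open>R\<^sub>i \<leadsto> S\<^sub>i\<close>. This and \<open>S\<^sub>i\<^sub>+\<^sub>1 \<leadsto> R\<^sub>i\<^sub>+\<^sub>1\<close> (in the last row \<open>S\<^sub>n \<leadsto> R\<^sub>n\<close>, which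
  holds because \<open>Y\<close> has dense range) give enough of Property (H) to make row \<open>i\<close> of both
  \<open>X\<close> and \<open>Y\<close> upper triangular. Then \<open>(X Y)\<^sub>i\<^sub>i = X\<^sub>i\<^sub>i Y\<^sub>i\<^sub>i\<close>, so \<open>Y\<^sub>i\<^sub>i\<close> is nonzero and
  \<open>S\<^sub>i \<leadsto> R\<^sub>i\<close> (\<open>upper_and_intertwined\<close>).
\<close>

section \<open>Bounded operators between closed subspaces\<close>

interpretation complex_vs: vector_space "scaleC :: complex \<Rightarrow> 'a \<Rightarrow> 'a::complex_hilbert"
  by (rule vector_space_scaleC)

context
  fixes H :: "'a::complex_hilbert set" and K :: "'b::complex_hilbert set" and X
  assumes X: "X \<in> bounded_ops H K"
begin

lemma bounded_ops_mem: "x \<in> H \<Longrightarrow> X x \<in> K"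
  and bounded_ops_add: "x \<in> H \<Longrightarrow> y \<in> H \<Longrightarrow> X (x + y) = X x + X y"
  and bounded_ops_scaleC: "x \<in> H \<Longrightarrow> X (scaleC c x) = scaleC c (X x)"
  and bounded_ops_ext: "X \<in> extensional H"
  using X by (auto simp: bounded_ops_def PiE_def)

lemma bounded_ops_bound: "\<exists>B\<ge>0. \<forall>x\<in>H. norm (X x) \<le> B * norm x"
proof -
  obtain B where B: "\<forall>x\<in>H. norm (X x) \<le> B * norm x"
    using X by (auto simp: bounded_ops_def)
  have "norm (X x) \<le> \<bar>B\<bar> * norm x" if "x \<in> H" for x
    using B[rule_format, OF that] mult_right_mono[of B "\<bar>B\<bar>" "norm x"]
    by (meson abs_ge_self norm_ge_zero order_trans)
  then show ?thesis by (intro exI[of _ "\<bar>B\<bar>"]) simp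
qed

lemma bounded_ops_zero: "csubspace H \<Longrightarrow> X 0 = 0"
  using bounded_ops_add[of 0 0] complex_vs.subspace_0 by auto

lemma bounded_ops_diff:
  assumes "csubspace H" "x \<in> H" "y \<in> H"
  shows "X (x - y) = X x - X y"
  using bounded_ops_add[of "x - y" y] complex_vs.subspace_diff[OF assms] assms by simp

lemma bounded_ops_sum:
  assumes "csubspace H" "finite I" "\<And>i. i \<in> I \<Longrightarrow> f i \<in> H"
  shows "X (\<Sum>i\<in>I. f i) = (\<Sum>i\<in>I. X (f i))"
  using assms(2,3)
proof (induction I rule: finite_induct)
  case empty
  then show ?case using bounded_ops_zero[OF assms(1)] by simp
next
  case (insert i I)
  have "(\<Sum>i\<in>I. f i) \<in> H"
    using insert.prems by (intro complex_vs.subspace_sum[OF assms(1)]) simp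
  then show ?case using insert bounded_ops_add[of "f i" "\<Sum>i\<in>I. f i"] by simp
qed

lemma bounded_ops_eq_zero_op: "X = zero_op H \<longleftrightarrow> (\<forall>x\<in>H. X x = 0)"
proof
  assume "\<forall>x\<in>H. X x = 0"
  then show "X = zero_op H"
    by (intro extensionalityI[OF bounded_ops_ext]) (simp_all add: zero_op_def)
qed (simp add: zero_op_def)

end

lemma bounded_ops_I:
  assumes "X \<in> extensional H" "\<And>x. x \<in> H \<Longrightarrow> X x \<in> K"
    and "\<And>x y. x \<in> H \<Longrightarrow> y \<in> H \<Longrightarrow> X (x + y) = X x + X y"
    and "\<And>c x. x \<in> H \<Longrightarrow> X (scaleC c x) = scaleC c (X x)"
    and "\<And>x. x \<in> H \<Longrightarrow> norm (X x) \<le> B * norm x"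
  shows "X \<in> bounded_ops H K"
  using assms by (auto simp: bounded_ops_def PiE_def intro!: exI[of _ B])

lemma restrict_compose_bounded_ops:
  assumes G: "csubspace G" "G \<subseteq> H"
    and X: "X \<in> bounded_ops H K" and Y: "Y \<in> bounded_ops K L"
  shows "(\<lambda>x\<in>G. Y (X x)) \<in> bounded_ops G L"
proof -
  obtain a where a: "a \<ge> 0" "\<forall>x\<in>K. norm (Y x) \<le> a * norm x"
    using bounded_ops_bound[OF Y] by blast
  obtain b where b: "\<forall>x\<in>H. norm (X x) \<le> b * norm x"
    using bounded_ops_bound[OF X] by blast
  have GH: "x \<in> H" if "x \<in> G" for x using G(2) that by blast
  have bd: "norm (Y (X x)) \<le> (a * b) * norm x" if "x \<in> G" for x
    using order_trans[OF a(2)[rule_format, OF bounded_ops_mem[OF X GH[OF that]]]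
        mult_left_mono[OF b[rule_format, OF GH[OF that]] a(1)]]
    by (simp add: mult.assoc)
  show ?thesis
    by (rule bounded_ops_I[where B = "a * b"])
      (simp_all add: bd GH complex_vs.subspace_add[OF G(1)] complex_vs.subspace_scale[OF G(1)]
        bounded_ops_mem[OF X] bounded_ops_mem[OF Y] bounded_ops_add[OF X] bounded_ops_add[OF Y]
        bounded_ops_scaleC[OF X] bounded_ops_scaleC[OF Y])
qed

lemma compose_bounded_ops:
  assumes "csubspace H" "X \<in> bounded_ops H K" "Y \<in> bounded_ops K L"
  shows "compose H Y X \<in> bounded_ops H L"
  using restrict_compose_bounded_ops[OF assms(1) order_refl assms(2,3)]
  by (simp add: compose_def)

lemma diff_bounded_ops:
  assumes H: "csubspace H" and K: "csubspace K"
    and X: "X \<in> bounded_ops H K" and Y: "Y \<in> bounded_ops H K"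
  shows "(\<lambda>x\<in>H. X x - Y x) \<in> bounded_ops H K"
proof -
  obtain a where a: "\<forall>x\<in>H. norm (X x) \<le> a * norm x"
    using bounded_ops_bound[OF X] by blast
  obtain b where b: "\<forall>x\<in>H. norm (Y x) \<le> b * norm x"
    using bounded_ops_bound[OF Y] by blast
  have bd: "norm (X x - Y x) \<le> (a + b) * norm x" if "x \<in> H" for x
    using norm_triangle_ineq4[of "X x" "Y x"] a[rule_format, OF that] b[rule_format, OF that]
    by (simp add: algebra_simps)
  show ?thesis
    by (rule bounded_ops_I[where B = "a + b"])
      (simp_all add: bd complex_vs.subspace_add[OF H] complex_vs.subspace_scale[OF H]
        complex_vs.subspace_diff[OF K] bounded_ops_mem[OF X] bounded_ops_mem[OF Y]
        bounded_ops_add[OF X] bounded_ops_add[OF Y] bounded_ops_scaleC[OF X]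
        bounded_ops_scaleC[OF Y] complex_vs.scale_right_diff_distrib)
qed

lemma id_op_bounded_ops: "csubspace H \<Longrightarrow> id_op H \<in> bounded_ops H H"
  by (rule bounded_ops_I[where B = 1])
    (simp_all add: id_op_def complex_vs.subspace_add complex_vs.subspace_scale)

lemma zero_on_dense_range:
  assumes Z: "Z \<in> bounded_ops L G" and L: "csubspace L"
    and X: "X ` K \<subseteq> L" "dense_range K L X"
    and zero: "\<And>x. x \<in> K \<Longrightarrow> Z (X x) = 0"
    and y: "y \<in> L"
  shows "Z y = 0"
proof -
  obtain B where B: "B \<ge> 0" "\<forall>x\<in>L. norm (Z x) \<le> B * norm x"
    using bounded_ops_bound[OF Z] by blast
  have "norm (Z y) \<le> e" if e: "e > 0" for e
  proof -
    have "y \<in> closure (X ` K)" using X y by (auto simp: dense_range_def)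
    moreover have "0 < e / (B + 1)" using e B(1) by simp
    ultimately obtain x where x: "x \<in> K" "dist (X x) y < e / (B + 1)"
      unfolding closure_approachable by blast
    have xL: "X x \<in> L" using x X by auto
    have "Z y = Z (y - X x)"
      using bounded_ops_diff[OF Z L y xL] zero[OF x(1)] by simp
    also have "norm \<dots> \<le> B * norm (y - X x)"
      using B(2) complex_vs.subspace_diff[OF L y xL] by blast
    also have "\<dots> \<le> (B + 1) * (e / (B + 1))"
      using x(2) B(1) by (intro mult_mono) (auto simp: dist_norm norm_minus_commute)
    also have "\<dots> = e" using B(1) by simp
    finally show ?thesis .
  qed
  then have "norm (Z y) \<le> 0" by (rule field_le_epsilon) simp
  then show ?thesis by simp
qed


section \<open>Nonzero intertwiners and Property (H)\<close>

definition intertwiners ::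
    "'a::complex_hilbert set \<Rightarrow> ('a \<Rightarrow> 'a) \<Rightarrow> 'b::complex_hilbert set \<Rightarrow> ('b \<Rightarrow> 'b) \<Rightarrow> ('a \<Rightarrow> 'b) set"
  where "intertwiners H T K S = {X \<in> bounded_ops H K. \<forall>x\<in>H. X (T x) = S (X x)}"

definition intertwined ::
    "'a::complex_hilbert set \<Rightarrow> ('a \<Rightarrow> 'a) \<Rightarrow> 'b::complex_hilbert set \<Rightarrow> ('b \<Rightarrow> 'b) \<Rightarrow> bool"
  where "intertwined H T K S \<longleftrightarrow> (\<exists>X\<in>intertwiners H T K S. X \<noteq> zero_op H)"

lemma compose_eq_iff: "compose H A B = compose H C D \<longleftrightarrow> (\<forall>x\<in>H. A (B x) = C (D x))"
  by (auto simp: compose_def restrict_def fun_eq_iff)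

lemma intertwiners_iff:
  "X \<in> intertwiners H T K S \<longleftrightarrow> X \<in> bounded_ops H K \<and> compose H S X = compose H X T"
  by (auto simp: intertwiners_def compose_eq_iff)

lemma compose_intertwiners:
  assumes H: "csubspace H" and T: "T \<in> bounded_ops H H"
    and X: "X \<in> intertwiners H T K S" and Y: "Y \<in> intertwiners K S L R"
  shows "compose H Y X \<in> intertwiners H T L R"
proof -
  have Xb: "X \<in> bounded_ops H K" and Yb: "Y \<in> bounded_ops K L"
    using X Y by (simp_all add: intertwiners_def)
  have "Y (X (T x)) = R (Y (X x))" if "x \<in> H" for x
    using X Y that bounded_ops_mem[OF Xb that] by (simp add: intertwiners_def)
  then show ?thesis
    using compose_bounded_ops[OF H Xb Yb] bounded_ops_mem[OF T]
    by (simp add: intertwiners_def compose_eq)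
qed

context
  fixes \<A> :: "('h::complex_hilbert set \<times> ('h \<Rightarrow> 'h)) set"
  assumes \<A>: "dense_range_class \<A>"
begin

lemma dense_range_class_subspace: "(H, T) \<in> \<A> \<Longrightarrow> csubspace H"
  and dense_range_class_op: "(H, T) \<in> \<A> \<Longrightarrow> T \<in> bounded_ops H H"
  using \<A> unfolding dense_range_class_def separable_hilbert_def by blast+

lemma intertwiner_dense_range:
  assumes "(H, T) \<in> \<A>" "(K, S) \<in> \<A>" "X \<in> intertwiners H T K S" "X \<noteq> zero_op H"
  shows "dense_range H K X"
proof -
  have "\<forall>X\<in>bounded_ops H K. X \<noteq> zero_op H \<and> compose H S X = compose H X T \<longrightarrow> dense_range H K X"
    using \<A> assms(1,2) unfolding dense_range_class_def by blast
  then show ?thesis using assms(3,4) unfolding intertwiners_iff by blast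
qed

text \<open>
  In the class, nonzero intertwiners are epimorphisms for bounded operators. This is what makes
  the relation \<open>intertwined\<close> transitive.
\<close>

lemma zero_after_intertwiner:
  assumes "(H, T) \<in> \<A>" "(K, S) \<in> \<A>" "X \<in> intertwiners H T K S" "X \<noteq> zero_op H"
    and Z: "Z \<in> bounded_ops K L" and "\<And>x. x \<in> H \<Longrightarrow> Z (X x) = 0"
  shows "Z = zero_op K"
proof -
  have "X ` H \<subseteq> K" using assms(3) bounded_ops_mem by (auto simp: intertwiners_def)
  then have "Z y = 0" if "y \<in> K" for y
    by (rule zero_on_dense_range[OF Z dense_range_class_subspace[OF assms(2)] _
        intertwiner_dense_range[OF assms(1-4)] assms(6) that])
  then show ?thesis by (simp add: bounded_ops_eq_zero_op[OF Z])
qed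

lemma compose_intertwiner_nonzero:
  assumes "(H, T) \<in> \<A>" "(K, S) \<in> \<A>" "X \<in> intertwiners H T K S" "X \<noteq> zero_op H"
    and "Z \<in> bounded_ops K L" "Z \<noteq> zero_op K"
  shows "compose H Z X \<noteq> zero_op H"
proof
  assume "compose H Z X = zero_op H"
  then have "Z (X x) = 0" if "x \<in> H" for x
    using that compose_eq[OF that, of Z X] by (simp add: zero_op_def)
  then show False using zero_after_intertwiner[OF assms(1-5)] assms(6) by blast
qed

lemma intertwined_trans:
  assumes "(H, T) \<in> \<A>" "(K, S) \<in> \<A>" "(L, R) \<in> \<A>"
    and "intertwined H T K S" "intertwined K S L R"
  shows "intertwined H T L R"
proof -
  obtain X where X: "X \<in> intertwiners H T K S" "X \<noteq> zero_op H"
    using assms(4) unfolding intertwined_def by blast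
  obtain Z where Z: "Z \<in> intertwiners K S L R" "Z \<noteq> zero_op K"
    using assms(5) unfolding intertwined_def by blast
  have Zb: "Z \<in> bounded_ops K L" using Z(1) by (simp add: intertwiners_def)
  show ?thesis
    unfolding intertwined_def
  proof
    show "compose H Z X \<in> intertwiners H T L R"
      using compose_intertwiners[OF dense_range_class_subspace[OF assms(1)]
        dense_range_class_op[OF assms(1)] X(1) Z(1)] .
    show "compose H Z X \<noteq> zero_op H"
      using compose_intertwiner_nonzero[OF assms(1,2) X Zb Z(2)] .
  qed
qed

text \<open>
  If \<open>W = R Y - Y Q\<close> is an intertwiner, then so is \<open>U W V\<close>, for nonzero intertwiners \<open>U\<close> from
  \<open>R\<close> to \<open>S\<close> and \<open>V\<close> from \<open>S'\<close> to \<open>Q\<close>, and \<open>U W V = S (U Y V) - (U Y V) S'\<close>. Hence \<open>U W V = 0\<close>, and a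
  composition of nonzero intertwiners is nonzero.
\<close>

lemma property_H_transfer:
  assumes G: "(G, S) \<in> \<A>" and G': "(G', S') \<in> \<A>" and L: "(L, R) \<in> \<A>" and K: "(K, Q) \<in> \<A>"
    and PH: "property_H G S G' S'"
    and "intertwined L R G S" "intertwined G' S' K Q"
  shows "property_H L R K Q"
  unfolding property_H_def
proof (intro ballI impI, elim conjE bexE)
  fix W Y
  assume W: "W \<in> bounded_ops K L" and comm: "compose K R W = compose K W Q"
    and Y: "Y \<in> bounded_ops K L" and eq: "W = (\<lambda>x\<in>K. R (Y x) - Y (Q x))"
  obtain U where U: "U \<in> intertwiners L R G S" "U \<noteq> zero_op L"
    using assms(6) unfolding intertwined_def by blast
  obtain V where V: "V \<in> intertwiners G' S' K Q" "V \<noteq> zero_op G'"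
    using assms(7) unfolding intertwined_def by blast
  note sub = dense_range_class_subspace[OF L] dense_range_class_subspace[OF K]
    dense_range_class_subspace[OF G']
  have Ub: "U \<in> bounded_ops L G" and Vb: "V \<in> bounded_ops G' K"
    using U V by (auto simp: intertwiners_def)
  note mem = bounded_ops_mem[OF Ub] bounded_ops_mem[OF Vb] bounded_ops_mem[OF Y]
    bounded_ops_mem[OF W] bounded_ops_mem[OF dense_range_class_op[OF L]]
    bounded_ops_mem[OF dense_range_class_op[OF K]]
    bounded_ops_mem[OF dense_range_class_op[OF G']]
  have Wi: "W \<in> intertwiners K Q L R" using W comm by (simp add: intertwiners_iff)
  define W' where "W' = compose G' U (compose G' W V)"
  have W'i: "W' \<in> intertwiners G' S' G S"
    unfolding W'_def
    by (rule compose_intertwiners[OF sub(3) dense_range_class_op[OF G']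
        compose_intertwiners[OF sub(3) dense_range_class_op[OF G'] V(1) Wi] U(1)])
  have Y'b: "compose G' U (compose G' Y V) \<in> bounded_ops G' G"
    by (rule compose_bounded_ops[OF sub(3) compose_bounded_ops[OF sub(3) Vb Y] Ub])
  have W'eq: "W' = (\<lambda>x\<in>G'. S (compose G' U (compose G' Y V) x) - compose G' U (compose G' Y V) (S' x))"
  proof -
    have "U (W (V x)) = S (U (Y (V x))) - U (Y (V (S' x)))" if "x \<in> G'" for x
    proof -
      have "W (V x) = R (Y (V x)) - Y (V (S' x))"
        using eq mem(2)[OF that] V(1) that by (simp add: intertwiners_def)
      moreover have "U (R (Y (V x))) = S (U (Y (V x)))"
        using U(1) mem(3)[OF mem(2)[OF that]] by (simp add: intertwiners_def)
      ultimately show ?thesis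
        using bounded_ops_diff[OF Ub sub(1) mem(5)[OF mem(3)[OF mem(2)[OF that]]]
            mem(3)[OF mem(2)[OF mem(7)[OF that]]]] by simp
    qed
    then show ?thesis
      unfolding W'_def compose_def using mem(7) by (simp add: restrict_def fun_eq_iff)
  qed
  have "W' = zero_op G'"
    using PH W'i W'eq Y'b unfolding property_H_def intertwiners_iff by blast
  moreover have "W' \<noteq> zero_op G'" if nz: "W \<noteq> zero_op K"
  proof -
    have "compose G' W V \<in> intertwiners G' S' L R"
      by (rule compose_intertwiners[OF sub(3) dense_range_class_op[OF G'] V(1) Wi])
    moreover have "compose G' W V \<noteq> zero_op G'"
      using compose_intertwiner_nonzero[OF G' K V W nz] .
    ultimately show ?thesis
      unfolding W'_def by (rule compose_intertwiner_nonzero[OF G' L _ _ Ub U(2)])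
  qed
  ultimately show "W = zero_op K" by blast
qed

end


section \<open>Blocks with respect to direct decompositions\<close>

text \<open>
  This is \<open>op_entry\<close> with different decompositions of the domain and of the target.
\<close>

definition block ::
    "nat \<Rightarrow> (nat \<Rightarrow> 'a set) \<Rightarrow> (nat \<Rightarrow> 'b::complex_hilbert set) \<Rightarrow> ('a \<Rightarrow> 'b) \<Rightarrow> nat \<Rightarrow> nat \<Rightarrow> 'a \<Rightarrow> 'b"
  where "block n M N X i j = (\<lambda>x\<in>M j. component n N i (X x))"

lemma op_entry_eq_block: "op_entry n M T = block n M M T"
  by (simp add: op_entry_def block_def fun_eq_iff)

locale decomposition =
  fixes n :: nat and H :: "'a::complex_hilbert set" and M :: "nat \<Rightarrow> 'a set"
  assumes subspace: "csubspace H" and direct_sum: "topological_direct_sum H n M"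
begin

lemma summand: "i \<in> {1..n} \<Longrightarrow> csubspace (M i)" "i \<in> {1..n} \<Longrightarrow> M i \<subseteq> H"
  using direct_sum by (auto simp: topological_direct_sum_def)

lemma component_unique:
  assumes "f \<in> Pi\<^sub>E {1..n} M" "i \<in> {1..n}"
  shows "component n M i (\<Sum>k\<in>{1..n}. f k) = f i"
proof -
  have "(\<Sum>k\<in>{1..n}. f k) \<in> H"
    using assms summand by (intro complex_vs.subspace_sum[OF subspace]) (auto simp: PiE_def Pi_def)
  then have "\<exists>!g. g \<in> Pi\<^sub>E {1..n} M \<and> (\<Sum>k\<in>{1..n}. f k) = (\<Sum>k\<in>{1..n}. g k)"
    using direct_sum by (auto simp: topological_direct_sum_def)
  then have "(THE g. g \<in> Pi\<^sub>E {1..n} M \<and> (\<Sum>k\<in>{1..n}. f k) = (\<Sum>k\<in>{1..n}. g k)) = f"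
    using assms by (intro the1_equality) auto
  then show ?thesis by (simp add: component_def)
qed

lemma component_bounded_ops: "i \<in> {1..n} \<Longrightarrow> restrict (component n M i) H \<in> bounded_ops H (M i)"
  using direct_sum by (auto simp: topological_direct_sum_def)

lemma component_mem: "i \<in> {1..n} \<Longrightarrow> x \<in> H \<Longrightarrow> component n M i x \<in> M i"
  using bounded_ops_mem[OF component_bounded_ops, of i x] by simp

lemma sum_components:
  assumes x: "x \<in> H"
  shows "(\<Sum>k\<in>{1..n}. component n M k x) = x"
proof -
  obtain f where f: "f \<in> Pi\<^sub>E {1..n} M" "x = (\<Sum>k\<in>{1..n}. f k)"
    using direct_sum x unfolding topological_direct_sum_def by blast
  then show ?thesis using component_unique[OF f(1)] by (auto intro: sum.cong)
qed

lemma component_summand: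
  assumes i: "i \<in> {1..n}" and j: "j \<in> {1..n}" and x: "x \<in> M j"
  shows "component n M i x = (if i = j then x else 0)"
proof -
  define f where "f = (\<lambda>k\<in>{1..n}. if k = j then x else 0)"
  have "0 \<in> M k" if "k \<in> {1..n}" for k
    using complex_vs.subspace_0[OF summand(1)[OF that]] .
  then have "f \<in> Pi\<^sub>E {1..n} M"
    using x by (auto simp: f_def)
  moreover have "(\<Sum>k\<in>{1..n}. f k) = x"
    using j by (simp add: f_def)
  ultimately show ?thesis using component_unique[of f i] i by (simp add: f_def)
qed

lemma component_op_sum:
  assumes i: "i \<in> {1..n}" and "finite I" "\<And>k. k \<in> I \<Longrightarrow> f k \<in> H"
  shows "component n M i (\<Sum>k\<in>I. f k) = (\<Sum>k\<in>I. component n M i (f k))"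
  using bounded_ops_sum[OF component_bounded_ops[OF i] subspace, of I f] assms
    complex_vs.subspace_sum[OF subspace, of I f] by simp

lemma component_diff:
  assumes "i \<in> {1..n}" "x \<in> H" "y \<in> H"
  shows "component n M i (x - y) = component n M i x - component n M i y"
  using bounded_ops_diff[OF component_bounded_ops[OF assms(1)] subspace assms(2,3)] assms
    complex_vs.subspace_diff[OF subspace, of x y] by simp

end

lemma block_bounded_ops:
  assumes "decomposition n H M" "decomposition n K N" "X \<in> bounded_ops H K"
    and "i \<in> {1..n}" "j \<in> {1..n}"
  shows "block n M N X i j \<in> bounded_ops (M j) (N i)"
proof -
  interpret M: decomposition n H M by fact
  interpret N: decomposition n K N by fact
  have "block n M N X i j = (\<lambda>x\<in>M j. restrict (component n N i) K (X x))"
    using M.summand[OF assms(5)] bounded_ops_mem[OF assms(3)]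
    by (auto simp: block_def restrict_def fun_eq_iff)
  then show ?thesis
    using restrict_compose_bounded_ops[OF M.summand[OF assms(5)] assms(3)
        N.component_bounded_ops[OF assms(4)]] by simp
qed

lemma component_op:
  assumes "decomposition n H M" "decomposition n K N" "X \<in> bounded_ops H K"
    and i: "i \<in> {1..n}" and x: "x \<in> H"
  shows "component n N i (X x) = (\<Sum>k\<in>{1..n}. block n M N X i k (component n M k x))"
proof -
  interpret M: decomposition n H M by fact
  interpret N: decomposition n K N by fact
  have m: "component n M k x \<in> H" if "k \<in> {1..n}" for k
    using M.component_mem[OF that x] M.summand that by blast
  have "component n N i (X x) = component n N i (X (\<Sum>k\<in>{1..n}. component n M k x))"
    using M.sum_components[OF x] by simp
  also have "\<dots> = component n N i (\<Sum>k\<in>{1..n}. X (component n M k x))"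
    by (subst bounded_ops_sum[OF assms(3) M.subspace]) (use m in auto)
  also have "\<dots> = (\<Sum>k\<in>{1..n}. component n N i (X (component n M k x)))"
    by (rule N.component_op_sum[OF i]) (use m bounded_ops_mem[OF assms(3)] in auto)
  also have "\<dots> = (\<Sum>k\<in>{1..n}. block n M N X i k (component n M k x))"
    using M.component_mem[OF _ x] by (simp add: block_def)
  finally show ?thesis .
qed

text \<open>
  Matrix multiplication. The left-hand side is a component and not a block because this form
  needs no composition restricted to the domain.
\<close>

lemma block_compose:
  assumes "decomposition n H M" "decomposition n K N" "decomposition n L P"
    and X: "X \<in> bounded_ops H K" and Y: "Y \<in> bounded_ops K L"
    and "i \<in> {1..n}" "j \<in> {1..n}" "x \<in> M j"
  shows "component n P i (Y (X x)) = (\<Sum>k\<in>{1..n}. block n N P Y i k (block n M N X k j x))"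
proof -
  interpret M: decomposition n H M by fact
  have "x \<in> H" using M.summand assms by blast
  then show ?thesis
    using component_op[OF assms(2,3) Y assms(6), of "X x"] bounded_ops_mem[OF X] assms(8)
    by (simp add: block_def)
qed


section \<open>Flags and their intertwiners\<close>

definition upper_row ::
    "nat \<Rightarrow> (nat \<Rightarrow> 'a set) \<Rightarrow> (nat \<Rightarrow> 'b::complex_hilbert set) \<Rightarrow> ('a \<Rightarrow> 'b) \<Rightarrow> nat \<Rightarrow> bool"
  where "upper_row n M N X i \<longleftrightarrow> (\<forall>j\<in>{1..<i}. block n M N X i j = zero_op (M j))"

locale flag =
  fixes n :: nat and \<A> :: "('h::complex_hilbert set \<times> ('h \<Rightarrow> 'h)) set"
    and H :: "'h set" and M :: "nat \<Rightarrow> 'h set" and T :: "'h \<Rightarrow> 'h"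
  assumes n: "n \<ge> 2" and \<A>: "dense_range_class \<A>" and flag: "flag_class n \<A> H M T"
begin

sublocale decomposition n H M
  using flag by unfold_locales (auto simp: flag_class_def separable_hilbert_def)

abbreviation diag :: "nat \<Rightarrow> 'h \<Rightarrow> 'h" where "diag i \<equiv> block n M M T i i"

lemma op: "T \<in> bounded_ops H H"
  using flag by (auto simp: flag_class_def)

lemma diag_class: "i \<in> {1..n} \<Longrightarrow> (M i, diag i) \<in> \<A>"
  using flag by (auto simp: flag_class_def op_entry_eq_block)

lemma block_mem: "i \<in> {1..n} \<Longrightarrow> j \<in> {1..n} \<Longrightarrow> x \<in> M j \<Longrightarrow> block n M M T i j x \<in> M i"
  using bounded_ops_mem[OF block_bounded_ops[OF decomposition_axioms decomposition_axioms op]] .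

lemma block_below: "i \<in> {1..n} \<Longrightarrow> j \<in> {1..n} \<Longrightarrow> j < i \<Longrightarrow> x \<in> M j \<Longrightarrow> block n M M T i j x = 0"
  using flag by (auto simp: flag_class_def op_entry_eq_block zero_op_def)

lemma superdiagonal:
  assumes "i \<in> {1..<n}"
  shows "block n M M T i (Suc i) \<noteq> zero_op (M (Suc i))"
    and "block n M M T i (Suc i) \<in> intertwiners (M (Suc i)) (diag (Suc i)) (M i) (diag i)"
proof -
  from assms have i: "i \<in> {1..n-1}" by auto
  then show "block n M M T i (Suc i) \<noteq> zero_op (M (Suc i))"
    using flag unfolding flag_class_def op_entry_eq_block by simp
  show "block n M M T i (Suc i) \<in> intertwiners (M (Suc i)) (diag (Suc i)) (M i) (diag i)"
    using flag i assms block_bounded_ops[OF decomposition_axioms decomposition_axioms op, of i "Suc i"]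
    unfolding flag_class_def op_entry_eq_block intertwiners_iff by simp
qed

text \<open>
  All superdiagonal entries are nonzero, and every summand is the domain or the target of one.
\<close>

lemma summand_nonzero:
  assumes "i \<in> {1..n}"
  shows "\<exists>x\<in>M i. x \<noteq> 0"
proof (cases "i = n")
  case False
  then have i: "i \<in> {1..<n}" using assms by auto
  have "block n M M T i (Suc i) \<in> bounded_ops (M (Suc i)) (M i)"
    using superdiagonal(2)[OF i] by (simp add: intertwiners_def)
  then obtain x where "x \<in> M (Suc i)" "block n M M T i (Suc i) x \<noteq> 0"
    using superdiagonal(1)[OF i] bounded_ops_eq_zero_op by blast
  then show ?thesis using block_mem[of i "Suc i" x] i by auto
next
  case True
  define j where "j = n - 1"
  have j: "j \<in> {1..<n}" "Suc j = i" using True n by (auto simp: j_def)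
  show ?thesis
  proof (rule ccontr)
    assume "\<not> ?thesis"
    then have z: "\<forall>x\<in>M i. x = 0" by blast
    have b: "block n M M T j i \<in> bounded_ops (M i) (M j)"
      using superdiagonal(2)[OF j(1)] j by (simp add: intertwiners_def)
    have "block n M M T j i = zero_op (M i)"
      unfolding bounded_ops_eq_zero_op[OF b]
      using z bounded_ops_zero[OF b] summand(1)[OF assms] by auto
    then show False using superdiagonal(1)[OF j(1)] j by simp
  qed
qed

text \<open>
  Intertwiners run from larger to smaller indices: compose superdiagonal entries. For \<open>i = j\<close>
  this is the identity, which is nonzero because the summand is.
\<close>

lemma diag_intertwined:
  assumes "1 \<le> i" "i \<le> j" "j \<le> n"
  shows "intertwined (M j) (diag j) (M i) (diag i)"
  using assms(2,3)
proof (induction j rule: dec_induct)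
  case base
  have i: "i \<in> {1..n}" using assms by auto
  have "id_op (M i) \<in> intertwiners (M i) (diag i) (M i) (diag i)"
    using id_op_bounded_ops[OF summand(1)[OF i]] block_mem[OF i i]
    by (auto simp: intertwiners_def id_op_def)
  moreover have "id_op (M i) \<noteq> zero_op (M i)"
    using summand_nonzero[OF i] by (auto simp: id_op_def zero_op_def restrict_def fun_eq_iff)
  ultimately show ?case unfolding intertwined_def by blast
next
  case (step m)
  then have m: "m \<in> {1..<n}" using assms by auto
  have "intertwined (M (Suc m)) (diag (Suc m)) (M m) (diag m)"
    using superdiagonal[OF m] unfolding intertwined_def by blast
  then show ?case
    using intertwined_trans[OF \<A> diag_class diag_class diag_class, of "Suc m" m i] step m assms
    by auto
qed

end

locale flag_intertwiner =
  dom: flag n \<A> H M T + cod: flag n \<A> K N S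
  for n :: nat and \<A> :: "('h::complex_hilbert set \<times> ('h \<Rightarrow> 'h)) set"
    and H M T K N S +
  fixes X :: "'h \<Rightarrow> 'h"
  assumes X: "X \<in> intertwiners H T K S"
begin

abbreviation B :: "nat \<Rightarrow> nat \<Rightarrow> 'h \<Rightarrow> 'h" where "B \<equiv> block n M N X"

lemma bounded: "X \<in> bounded_ops H K"
  using X by (simp add: intertwiners_def)

lemma B_bounded: "i \<in> {1..n} \<Longrightarrow> j \<in> {1..n} \<Longrightarrow> B i j \<in> bounded_ops (M j) (N i)"
  using block_bounded_ops[OF dom.decomposition_axioms cod.decomposition_axioms bounded] .

lemma B_zero: "i \<in> {1..n} \<Longrightarrow> j \<in> {1..n} \<Longrightarrow> B i j 0 = 0"
  using bounded_ops_zero[OF B_bounded dom.summand(1)] .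

lemma entry_equation:
  assumes "i \<in> {1..n}" "j \<in> {1..n}" "x \<in> M j"
  shows "(\<Sum>k\<in>{1..n}. B i k (block n M M T k j x)) =
    (\<Sum>k\<in>{1..n}. block n N N S i k (B k j x))"
proof -
  have "X (T x) = S (X x)" using X dom.summand assms by (auto simp: intertwiners_def)
  then show ?thesis
    using block_compose[OF dom.decomposition_axioms dom.decomposition_axioms
        cod.decomposition_axioms dom.op bounded assms]
      block_compose[OF dom.decomposition_axioms cod.decomposition_axioms
        cod.decomposition_axioms bounded cod.op assms]
    by simp
qed

text \<open>
  The relation \<open>X T = S X\<close> at the entry \<open>(i, j)\<close> when row \<open>i\<close> of \<open>X\<close> starts at column \<open>l\<close> and
  column \<open>j\<close> of \<open>X\<close> ends at row \<open>r\<close>. As \<open>T\<close> and \<open>S\<close> are upper triangular, only the terms between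
  these bounds survive. It is used with at most two terms on each side.
\<close>

lemma entry_equation_reduced:
  assumes i: "i \<in> {1..n}" and j: "j \<in> {1..n}" and x: "x \<in> M j"
    and left: "\<And>k. k \<in> {1..<l} \<Longrightarrow> B i k = zero_op (M k)" and l: "1 \<le> l"
    and below: "\<And>k. k \<in> {r<..n} \<Longrightarrow> B k j = zero_op (M j)" and r: "r \<le> n"
  shows "(\<Sum>k\<in>{l..j}. B i k (block n M M T k j x)) = (\<Sum>k\<in>{i..r}. block n N N S i k (B k j x))"
proof -
  have "(\<Sum>k\<in>{l..j}. B i k (block n M M T k j x)) = (\<Sum>k\<in>{1..n}. B i k (block n M M T k j x))"
  proof (rule sum.mono_neutral_left)
    show "\<forall>k\<in>{1..n} - {l..j}. B i k (block n M M T k j x) = 0"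
    proof
      fix k assume k: "k \<in> {1..n} - {l..j}"
      show "B i k (block n M M T k j x) = 0"
      proof (cases "k < l")
        case True
        then have "B i k = zero_op (M k)" using left k by auto
        then show ?thesis using dom.block_mem[of k j x] k j x by (simp add: zero_op_def)
      next
        case False
        then have "block n M M T k j x = 0" using dom.block_below[of k j x] k j x by auto
        then show ?thesis using B_zero i k by auto
      qed
    qed
  qed (use j l in auto)
  also have "\<dots> = (\<Sum>k\<in>{1..n}. block n N N S i k (B k j x))"
    using entry_equation[OF i j x] .
  also have "\<dots> = (\<Sum>k\<in>{i..r}. block n N N S i k (B k j x))"
  proof (rule sum.mono_neutral_right)
    show "\<forall>k\<in>{1..n} - {i..r}. block n N N S i k (B k j x) = 0"
    proof
      fix k assume k: "k \<in> {1..n} - {i..r}"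
      have kn: "k \<in> {1..n}" using k by auto
      show "block n N N S i k (B k j x) = 0"
      proof (cases "k < i")
        case True
        then show ?thesis
          using cod.block_below[OF i kn] bounded_ops_mem[OF B_bounded[OF kn j] x] by auto
      next
        case False
        then have "B k j x = 0" using below[of k] k x by (simp add: zero_op_def)
        then show ?thesis
          using bounded_ops_zero[OF block_bounded_ops[OF cod.decomposition_axioms
                cod.decomposition_axioms cod.op i kn] cod.summand(1)[OF kn]] by simp
      qed
    qed
  qed (use i r in auto)
  finally show ?thesis .
qed

text \<open>
  At the first entry of row \<open>i\<close> both sums of the entry equation have one term.
\<close>

lemma first_entry_intertwiner:
  assumes i: "i \<in> {1..n}" and ji: "j \<in> {1..i}"
    and rows: "\<And>a. a \<in> {i<..n} \<Longrightarrow> upper_row n M N X a"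
    and left: "\<And>k. k \<in> {1..<j} \<Longrightarrow> B i k = zero_op (M k)"
  shows "B i j \<in> intertwiners (M j) (dom.diag j) (N i) (cod.diag i)"
proof -
  have j: "j \<in> {1..n}" using i ji by auto
  have "B i j (dom.diag j x) = cod.diag i (B i j x)" if "x \<in> M j" for x
  proof -
    have "(\<Sum>k\<in>{j..j}. B i k (block n M M T k j x)) =
        (\<Sum>k\<in>{i..i}. block n N N S i k (B k j x))"
      by (rule entry_equation_reduced[OF i j that left])
        (use i ji rows in \<open>auto simp: upper_row_def\<close>)
    then show ?thesis by simp
  qed
  then show ?thesis using B_bounded[OF i j] by (auto simp: intertwiners_def)
qed

text \<open>
  The first nonzero entry of row \<open>i\<close> intertwines the \<open>j\<close>-th diagonal entry of the domain with the
  \<open>i\<close>-th of the target for some \<open>j \<le> i\<close>; precompose with an intertwiner from index \<open>i\<close> to \<open>j\<close>.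
\<close>

lemma intertwined_of_nonzero_entry:
  assumes i: "i \<in> {1..n}" and k: "k \<in> {1..i}" "B i k \<noteq> zero_op (M k)"
    and rows: "\<And>a. a \<in> {i<..n} \<Longrightarrow> upper_row n M N X a"
  shows "intertwined (M i) (dom.diag i) (N i) (cod.diag i)"
proof -
  define j where "j = (LEAST k. k \<ge> 1 \<and> B i k \<noteq> zero_op (M k))"
  have "j \<ge> 1 \<and> B i j \<noteq> zero_op (M j)"
    unfolding j_def by (rule LeastI[of _ k]) (use k in auto)
  moreover have "j \<le> k" unfolding j_def by (rule Least_le) (use k in auto)
  moreover have "B i l = zero_op (M l)" if "l \<in> {1..<j}" for l
    using not_less_Least[of l "\<lambda>k. k \<ge> 1 \<and> B i k \<noteq> zero_op (M k)"] that
    by (auto simp: j_def)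
  ultimately have "intertwined (M j) (dom.diag j) (N i) (cod.diag i)" "1 \<le> j" "j \<le> i"
    using first_entry_intertwiner[OF i, of j] k rows unfolding intertwined_def by auto
  then show ?thesis
    using intertwined_trans[OF dom.\<A> dom.diag_class dom.diag_class cod.diag_class, of i j i]
      dom.diag_intertwined[of j i] i by auto
qed

text \<open>
  The entries left of the diagonal vanish one after the other. If those before \<open>j\<close> do, the
  equation at \<open>(i, j+1)\<close> says that \<open>X\<^sub>i\<^sub>j T\<^sub>j\<^sub>,\<^sub>j\<^sub>+\<^sub>1 = S\<^sub>i\<^sub>i X\<^sub>i\<^sub>,\<^sub>j\<^sub>+\<^sub>1 - X\<^sub>i\<^sub>,\<^sub>j\<^sub>+\<^sub>1 T\<^sub>j\<^sub>+\<^sub>1\<^sub>,\<^sub>j\<^sub>+\<^sub>1\<close>. The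
  left-hand side intertwines the diagonal entries \<open>T\<^sub>j\<^sub>+\<^sub>1\<^sub>,\<^sub>j\<^sub>+\<^sub>1\<close> and \<open>S\<^sub>i\<^sub>i\<close>, so Property (H) makes it zero.
\<close>

lemma upper_row_step:
  assumes i: "i \<in> {1..n}"
    and rows: "\<And>a. a \<in> {i<..n} \<Longrightarrow> upper_row n M N X a"
    and PH: "\<And>j. j \<in> {1..<i} \<Longrightarrow>
      property_H (N i) (cod.diag i) (M (Suc j)) (dom.diag (Suc j))"
  shows "upper_row n M N X i"
proof -
  have "B i j = zero_op (M j)" if "j \<in> {1..<i}" for j
    using that
  proof (induction j rule: less_induct)
    case (less j)
    have left: "B i k = zero_op (M k)" if "k \<in> {1..<j}" for k
      using less that by auto
    have j: "j \<in> {1..n}" and sj: "Suc j \<in> {1..n}" and jn: "j \<in> {1..<n}"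
      using less i by auto
    let ?D = "block n M M T j (Suc j)"
    note D = dom.superdiagonal[OF jn]
    have Bi: "B i j \<in> intertwiners (M j) (dom.diag j) (N i) (cod.diag i)"
      using first_entry_intertwiner[OF i _ rows left] less by auto
    define W where "W = compose (M (Suc j)) (B i j) ?D"
    have Wi: "W \<in> intertwiners (M (Suc j)) (dom.diag (Suc j)) (N i) (cod.diag i)"
      unfolding W_def
      using compose_intertwiners[OF dom.summand(1)[OF sj] _ D(2) Bi]
        dense_range_class_op[OF dom.\<A> dom.diag_class[OF sj]] by blast
    have "W = (\<lambda>x\<in>M (Suc j). cod.diag i (B i (Suc j) x) - B i (Suc j) (dom.diag (Suc j) x))"
    proof -
      have "B i j (?D x) = cod.diag i (B i (Suc j) x) - B i (Suc j) (dom.diag (Suc j) x)"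
        if x: "x \<in> M (Suc j)" for x
      proof -
        have "(\<Sum>k\<in>{j..Suc j}. B i k (block n M M T k (Suc j) x)) =
            (\<Sum>k\<in>{i..i}. block n N N S i k (B k (Suc j) x))"
          by (rule entry_equation_reduced[OF i sj x left])
            (use i less rows in \<open>auto simp: upper_row_def\<close>)
        then show ?thesis by (simp add: algebra_simps)
      qed
      then show ?thesis by (auto simp: W_def compose_def restrict_def fun_eq_iff)
    qed
    then have "W = zero_op (M (Suc j))"
      using PH[of j] less Wi B_bounded[OF i sj] unfolding property_H_def intertwiners_iff by blast
    then show ?case
      using compose_intertwiner_nonzero[OF dom.\<A> dom.diag_class[OF sj] dom.diag_class[OF j]
          D(2,1) B_bounded[OF i j]] unfolding W_def by blast
  qed
  then show ?thesis by (simp add: upper_row_def)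
qed

text \<open>
  The difference of the two sides intertwines \<open>T\<^sub>i\<^sub>+\<^sub>1\<^sub>,\<^sub>i\<^sub>+\<^sub>1\<close> and \<open>S\<^sub>i\<^sub>i\<close>, and the equation at
  \<open>(i, i+1)\<close> expresses it as \<open>S\<^sub>i\<^sub>i X\<^sub>i\<^sub>,\<^sub>i\<^sub>+\<^sub>1 - X\<^sub>i\<^sub>,\<^sub>i\<^sub>+\<^sub>1 T\<^sub>i\<^sub>+\<^sub>1\<^sub>,\<^sub>i\<^sub>+\<^sub>1\<close>.
\<close>

lemma diagonal_relation:
  assumes i: "i \<in> {1..<n}"
    and rows: "\<And>a. a \<in> {i..n} \<Longrightarrow> upper_row n M N X a"
    and PH: "property_H (N i) (cod.diag i) (M (Suc i)) (dom.diag (Suc i))"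
    and x: "x \<in> M (Suc i)"
  shows "B i i (block n M M T i (Suc i) x) = block n N N S i (Suc i) (B (Suc i) (Suc i) x)"
proof -
  have i': "i \<in> {1..n}" and si: "Suc i \<in> {1..n}" using i by auto
  let ?D = "block n M M T i (Suc i)" and ?E = "block n N N S i (Suc i)"
  note sub = dom.summand(1)[OF si] dense_range_class_op[OF dom.\<A> dom.diag_class[OF si]]
  have Bi: "B i i \<in> intertwiners (M i) (dom.diag i) (N i) (cod.diag i)"
    using first_entry_intertwiner[OF i', of i] i rows by (auto simp: upper_row_def)
  have Bs: "B (Suc i) (Suc i) \<in>
      intertwiners (M (Suc i)) (dom.diag (Suc i)) (N (Suc i)) (cod.diag (Suc i))"
    using first_entry_intertwiner[OF si, of "Suc i"] i rows[of "Suc i"] rows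
    by (auto simp: upper_row_def)
  have W1: "compose (M (Suc i)) (B i i) ?D \<in>
      intertwiners (M (Suc i)) (dom.diag (Suc i)) (N i) (cod.diag i)"
    using compose_intertwiners[OF sub dom.superdiagonal(2)[OF i] Bi] .
  have W2: "compose (M (Suc i)) ?E (B (Suc i) (Suc i)) \<in>
      intertwiners (M (Suc i)) (dom.diag (Suc i)) (N i) (cod.diag i)"
    using compose_intertwiners[OF sub Bs cod.superdiagonal(2)[OF i]] .
  define W where "W = (\<lambda>x\<in>M (Suc i).
    compose (M (Suc i)) (B i i) ?D x - compose (M (Suc i)) ?E (B (Suc i) (Suc i)) x)"
  have Wb: "W \<in> bounded_ops (M (Suc i)) (N i)"
    unfolding W_def using diff_bounded_ops sub(1) cod.summand(1)[OF i'] W1 W2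
    by (auto simp: intertwiners_def)
  have Wi: "compose (M (Suc i)) (cod.diag i) W = compose (M (Suc i)) W (dom.diag (Suc i))"
    unfolding compose_eq_iff
  proof
    fix x assume x: "x \<in> M (Suc i)"
    have m: "compose (M (Suc i)) (B i i) ?D x \<in> N i"
      "compose (M (Suc i)) ?E (B (Suc i) (Suc i)) x \<in> N i"
      using W1 W2 bounded_ops_mem[OF _ x] unfolding intertwiners_def by blast+
    show "cod.diag i (W x) = W (dom.diag (Suc i) x)"
      using x dom.block_mem[OF si si x] W1 W2
        bounded_ops_diff[OF dense_range_class_op[OF cod.\<A> cod.diag_class[OF i']]
          cod.summand(1)[OF i'] m]
      unfolding W_def intertwiners_def by simp
  qed
  have Weq: "W = (\<lambda>x\<in>M (Suc i). cod.diag i (B i (Suc i) x) - B i (Suc i) (dom.diag (Suc i) x))"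
  proof -
    have "B i i (?D x) - ?E (B (Suc i) (Suc i) x) =
        cod.diag i (B i (Suc i) x) - B i (Suc i) (dom.diag (Suc i) x)"
      if x: "x \<in> M (Suc i)" for x
    proof -
      have "(\<Sum>k\<in>{i..Suc i}. B i k (block n M M T k (Suc i) x)) =
          (\<Sum>k\<in>{i..Suc i}. block n N N S i k (B k (Suc i) x))"
        by (rule entry_equation_reduced[OF i' si x]) (use i rows in \<open>auto simp: upper_row_def\<close>)
      then show ?thesis by (simp add: algebra_simps)
    qed
    then show ?thesis by (auto simp: W_def compose_def restrict_def fun_eq_iff)
  qed
  have "W = zero_op (M (Suc i))"
    using PH Wb Wi Weq B_bounded[OF i' si] unfolding property_H_def by blast
  then have "W x = 0" using x by (simp add: zero_op_def)
  then show ?thesis using x by (simp add: W_def compose_eq)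
qed

lemma nonzero_entry:
  assumes i: "i \<in> {1..n}" and x: "x \<in> H" "component n N i (X x) \<noteq> 0"
  shows "\<exists>k\<in>{1..n}. B i k \<noteq> zero_op (M k)"
proof (rule ccontr)
  assume "\<not> ?thesis"
  then have "B i k (component n M k x) = 0" if "k \<in> {1..n}" for k
    using that dom.component_mem[OF that x(1)] by (simp add: zero_op_def)
  then show False
    using component_op[OF dom.decomposition_axioms cod.decomposition_axioms bounded i x(1)] x(2)
    by simp
qed


end

lemma downward_induct [consumes 1, case_names step]:
  fixes i n :: nat
  assumes "i \<in> {1..n}"
    and step: "\<And>i. i \<in> {1..n} \<Longrightarrow> (\<And>a. a \<in> {i<..n} \<Longrightarrow> Q a) \<Longrightarrow> Q i"
  shows "Q i"
  using assms(1)
proof (induction "n - i" arbitrary: i rule: less_induct)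
  case less
  show ?case by (rule step[OF less.prems]) (use less in auto)
qed

lemma block_compose_upper:
  assumes "decomposition n H M" "decomposition n K N" "decomposition n L P"
    and X: "X \<in> bounded_ops H K" and Y: "Y \<in> bounded_ops K L"
    and i: "i \<in> {1..n}" and x: "x \<in> M i"
    and rows: "\<And>a. a \<in> {i<..n} \<Longrightarrow> upper_row n M N X a"
  shows "component n P i (Y (X x)) = (\<Sum>k\<in>{1..i}. block n N P Y i k (block n M N X k i x))"
proof -
  interpret N: decomposition n K N by fact
  have "component n P i (Y (X x)) = (\<Sum>k\<in>{1..n}. block n N P Y i k (block n M N X k i x))"
    by (rule block_compose[OF assms(1-5) i i x])
  also have "\<dots> = (\<Sum>k\<in>{1..i}. block n N P Y i k (block n M N X k i x))"
  proof (rule sum.mono_neutral_right)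
    show "\<forall>k\<in>{1..n} - {1..i}. block n N P Y i k (block n M N X k i x) = 0"
    proof
      fix k assume k: "k \<in> {1..n} - {1..i}"
      then have "block n M N X k i x = 0"
        using rows[of k] i x by (auto simp: upper_row_def zero_op_def)
      moreover have kn: "k \<in> {1..n}" using k by auto
      ultimately show "block n N P Y i k (block n M N X k i x) = 0"
        using bounded_ops_zero[OF block_bounded_ops[OF assms(2,3) Y i kn] N.summand(1)[OF kn]]
        by simp
    qed
  qed (use i in auto)
  finally show ?thesis .
qed

lemma block_compose_diagonal:
  assumes "decomposition n H M" "decomposition n K N" "decomposition n L P"
    and X: "X \<in> bounded_ops H K" and Y: "Y \<in> bounded_ops K L"
    and i: "i \<in> {1..n}" and x: "x \<in> M i"
    and rows: "\<And>a. a \<in> {i<..n} \<Longrightarrow> upper_row n M N X a" "upper_row n N P Y i"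
  shows "component n P i (Y (X x)) = block n N P Y i i (block n M N X i i x)"
proof -
  have "block n N P Y i k (block n M N X k i x) = 0" if "k \<in> {1..i} - {i}" for k
  proof -
    have k: "k \<in> {1..n}" "k \<in> {1..<i}" using i that by auto
    then show ?thesis
      using bounded_ops_mem[OF block_bounded_ops[OF assms(1,2) X k(1) i] x] rows(2)
      by (simp add: upper_row_def zero_op_def)
  qed
  then have "(\<Sum>k\<in>{1..i}. block n N P Y i k (block n M N X k i x)) =
      (\<Sum>k\<in>{i}. block n N P Y i k (block n M N X k i x))"
    using i by (intro sum.mono_neutral_right) auto
  then show ?thesis using block_compose_upper[OF assms(1-5) i x rows(1)] by simp
qed


section \<open>Flags with Property (H)\<close>

locale flag_H = flag +
  assumes property_H: "i \<in> {1..<n} \<Longrightarrow> property_H (M i) (diag i) (M (Suc i)) (diag (Suc i))"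
begin

text \<open>
  In \<open>upper_row_step\<close>, Property (H) is needed for the pairs \<open>(i, j+1)\<close> with \<open>j < i\<close>. It comes from
  the pair \<open>(j, j+1)\<close>, as there is a nonzero intertwiner from index \<open>i\<close> to index \<open>j\<close>.
\<close>

lemma commutant_upper:
  assumes X: "X \<in> intertwiners H T H T" and i: "i \<in> {1..n}"
  shows "upper_row n M M X i"
proof -
  interpret X: flag_intertwiner n \<A> H M T H M T X
    by unfold_locales (fact X)
  show ?thesis
    using i
  proof (induction rule: downward_induct)
    case (step i)
    show ?case
    proof (rule X.upper_row_step[OF step])
      fix j assume j: "j \<in> {1..<i}"
      have m: "j \<in> {1..<n}" "j \<in> {1..n}" "Suc j \<in> {1..n}" using j step by auto
      show "property_H (M i) (diag i) (M (Suc j)) (diag (Suc j))"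
        by (rule property_H_transfer[OF \<A> diag_class[OF m(2)] diag_class[OF m(3)]
              diag_class[OF step(1)] diag_class[OF m(3)] property_H[OF m(1)]])
          (use j m step in \<open>auto intro!: diag_intertwined\<close>)
    qed
  qed
qed

lemma commutant_diagonal:
  assumes X: "X \<in> intertwiners H T H T" and i: "i \<in> {1..<n}" and x: "x \<in> M (Suc i)"
  shows "block n M M X i i (block n M M T i (Suc i) x) =
    block n M M T i (Suc i) (block n M M X (Suc i) (Suc i) x)"
proof -
  interpret X: flag_intertwiner n \<A> H M T H M T X
    by unfold_locales (fact X)
  show ?thesis
    by (rule X.diagonal_relation[OF i _ property_H[OF i] x])
      (use commutant_upper[OF X] i in auto)
qed

lemma commutant_diag_intertwiner:
  assumes X: "X \<in> intertwiners H T H T" and i: "i \<in> {1..n}"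
  shows "block n M M X i i \<in> intertwiners (M i) (diag i) (M i) (diag i)"
proof -
  interpret X: flag_intertwiner n \<A> H M T H M T X
    by unfold_locales (fact X)
  have "block n M M X i k = zero_op (M k)" if "k \<in> {1..<i}" for k
    using commutant_upper[OF X i] that by (simp add: upper_row_def)
  then show ?thesis
    using X.first_entry_intertwiner[OF i, of i] commutant_upper[OF X] i by auto
qed

text \<open>
  The assumption makes the last diagonal entry nonzero, since the rest of the last row
  vanishes. The diagonal relation \<open>X\<^sub>i\<^sub>i T\<^sub>i\<^sub>,\<^sub>i\<^sub>+\<^sub>1 = T\<^sub>i\<^sub>,\<^sub>i\<^sub>+\<^sub>1 X\<^sub>i\<^sub>+\<^sub>1\<^sub>,\<^sub>i\<^sub>+\<^sub>1\<close> carries this upwards, because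
  its right-hand side is a composition of nonzero intertwiners.
\<close>

lemma commutant_diag_nonzero:
  assumes X: "X \<in> intertwiners H T H T" and x: "x \<in> H" "component n M n (X x) \<noteq> 0"
    and i: "i \<in> {1..n}"
  shows "block n M M X i i \<noteq> zero_op (M i)"
  using i
proof (induction rule: downward_induct)
  case (step i)
  interpret X: flag_intertwiner n \<A> H M T H M T X
    by unfold_locales (fact X)
  show ?case
  proof (cases "i = n")
    case True
    obtain k where k: "k \<in> {1..n}" "block n M M X n k \<noteq> zero_op (M k)"
      using X.nonzero_entry[of n x] x n by auto
    moreover have "block n M M X n j = zero_op (M j)" if "j \<in> {1..<n}" for j
      using commutant_upper[OF X, of n] n that by (auto simp: upper_row_def)
    ultimately have "k = n" by (meson atLeastAtMost_iff atLeastLessThan_iff le_neq_implies_less)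
    then show ?thesis using k True by simp
  next
    case False
    then have i: "i \<in> {1..<n}" and si: "Suc i \<in> {1..n}" using step(1) by auto
    let ?D = "block n M M T i (Suc i)" and ?B = "block n M M X (Suc i) (Suc i)"
    have D: "?D \<in> bounded_ops (M (Suc i)) (M i)"
      using superdiagonal(2)[OF i] by (simp add: intertwiners_def)
    have "compose (M (Suc i)) ?D ?B \<noteq> zero_op (M (Suc i))"
      by (rule compose_intertwiner_nonzero[OF \<A> diag_class[OF si] diag_class[OF si]
            commutant_diag_intertwiner[OF X si] step(2) D superdiagonal(1)[OF i]])
        (use i in auto)
    moreover have "compose (M (Suc i)) ?D ?B = zero_op (M (Suc i))"
      if "block n M M X i i = zero_op (M i)"
    proof -
      have "?D (?B x) = 0" if "x \<in> M (Suc i)" for x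
        using commutant_diagonal[OF X i that] \<open>block n M M X i i = zero_op (M i)\<close>
          bounded_ops_mem[OF D that] by (simp add: zero_op_def)
      then show ?thesis by (simp add: compose_def zero_op_def cong: restrict_cong)
    qed
    ultimately show ?thesis by blast
  qed
qed

text \<open>
  The diagonal of a commuting idempotent consists of zeros only or of identities only, and an
  upper triangular idempotent is determined by such a diagonal.
\<close>

lemma strongly_irreducible_flag:
  assumes SI: "\<And>i. i \<in> {1..n} \<Longrightarrow> strongly_irreducible (M i) (diag i)"
  shows "strongly_irreducible H T"
  unfolding strongly_irreducible_def
proof (intro ballI impI, elim conjE)
  fix P
  assume Pb: "P \<in> bounded_ops H H" and idem: "compose H P P = P"
    and comm: "compose H T P = compose H P T"
  let ?P = "\<lambda>i. block n M M P i i"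
  have PP: "P (P x) = P x" if "x \<in> H" for x
    using fun_cong[OF idem, of x] that by (simp add: compose_eq)
  have P: "P \<in> intertwiners H T H T" using Pb comm by (simp add: intertwiners_iff)
  note dec = decomposition_axioms
  \<comment> \<open>Triangularity makes the diagonal entries multiplicative, so \<open>P\<^sub>i\<^sub>i\<close> is idempotent.\<close>
  have dich: "?P i = zero_op (M i) \<or> ?P i = id_op (M i)" if i: "i \<in> {1..n}" for i
  proof -
    have Pi: "?P i \<in> intertwiners (M i) (diag i) (M i) (diag i)"
      by (rule commutant_diag_intertwiner[OF P i])
    have "?P i (?P i x) = ?P i x" if x: "x \<in> M i" for x
    proof -
      have "x \<in> H" using summand(2)[OF i] x by blast
      then show ?thesis
        using block_compose_diagonal[OF dec dec dec Pb Pb i x] commutant_upper[OF P] PP[of x] i x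
        by (simp add: block_def)
    qed
    then have "compose (M i) (?P i) (?P i) = ?P i"
      by (intro extensionalityI[of _ "M i"]) (simp_all add: compose_eq block_def)
    then show ?thesis
      using SI[OF i] Pi unfolding strongly_irreducible_def intertwiners_iff by blast
  qed
  have diag_step: "?P (Suc i) = zero_op (M (Suc i)) \<longleftrightarrow> ?P i = zero_op (M i)" if i: "i \<in> {1..<n}" for i
  proof -
    have i': "i \<in> {1..n}" "Suc i \<in> {1..n}" using i by auto
    have "block n M M T i (Suc i) \<in> bounded_ops (M (Suc i)) (M i)"
      using superdiagonal(2)[OF i] by (simp add: intertwiners_def)
    then obtain x where x: "x \<in> M (Suc i)" "block n M M T i (Suc i) x \<noteq> 0"
      using superdiagonal(1)[OF i] bounded_ops_eq_zero_op by blast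
    have m: "block n M M T i (Suc i) x \<in> M i" using block_mem[OF i' x(1)] .
    have z: "block n M M T i (Suc i) 0 = 0"
      using bounded_ops_zero[OF block_bounded_ops[OF dec dec op i'] summand(1)[OF i'(2)]] .
    note relation = commutant_diagonal[OF P i x(1)]
    have "?P i \<noteq> id_op (M i)" if "?P (Suc i) = zero_op (M (Suc i))"
      using relation that x m z by (auto simp: zero_op_def id_op_def)
    moreover have "?P (Suc i) \<noteq> id_op (M (Suc i))" if "?P i = zero_op (M i)"
      using relation that x m by (auto simp: zero_op_def id_op_def)
    ultimately show ?thesis using dich[OF i'(1)] dich[OF i'(2)] by blast
  qed
  have const: "?P i = zero_op (M i) \<longleftrightarrow> ?P n = zero_op (M n)" if "i \<in> {1..n}" for i
    using that
  proof (induction rule: downward_induct)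
    case (step i)
    show ?case
    proof (cases "i = n")
      case False
      then show ?thesis using step(2)[of "Suc i"] step(1) diag_step[of i] by auto
    qed simp
  qed
  \<comment> \<open>Back substitution: the components of \<open>y\<close> are shown to vanish from the last one to the first.\<close>
  have expand: "component n M i (P y) = ?P i (component n M i y)"
    if i: "i \<in> {1..n}" and y: "y \<in> H"
      and z: "\<And>a. a \<in> {i<..n} \<Longrightarrow> component n M a y = 0" for i y
  proof -
    have "block n M M P i k (component n M k y) = 0" if k: "k \<in> {1..n} - {i}" for k
    proof (cases "k < i")
      case True
      then show ?thesis
        using commutant_upper[OF P i] k component_mem[of k y] y
        by (auto simp: upper_row_def zero_op_def)
    next
      case False
      then have "component n M k y = 0" using z k by auto
      moreover have kn: "k \<in> {1..n}" using k by auto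
      ultimately show ?thesis
        using bounded_ops_zero[OF block_bounded_ops[OF dec dec Pb i kn] summand(1)[OF kn]] by simp
    qed
    then have "(\<Sum>k\<in>{1..n}. block n M M P i k (component n M k y)) =
        (\<Sum>k\<in>{i}. block n M M P i k (component n M k y))"
      using i by (intro sum.mono_neutral_right) auto
    then show ?thesis using component_op[OF dec dec Pb i y] by simp
  qed
  have vanish: "y = 0"
    if y: "y \<in> H" and descent: "\<And>i. i \<in> {1..n} \<Longrightarrow>
      component n M i (P y) = ?P i (component n M i y) \<Longrightarrow> component n M i y = 0" for y
  proof -
    have "component n M i y = 0" if "i \<in> {1..n}" for i
      using that
    proof (induction rule: downward_induct)
      case (step i)
      then show ?case using descent expand y by blast
    qed
    then show ?thesis using sum_components[OF y] by simp
  qed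
  show "P = zero_op H \<or> P = id_op H"
  proof (cases "?P n = zero_op (M n)")
    case True
    \<comment> \<open>The vector \<open>P x\<close> is fixed by \<open>P\<close>, whose diagonal is zero.\<close>
    have "P x = 0" if x: "x \<in> H" for x
    proof (rule vanish)
      show Px: "P x \<in> H" using bounded_ops_mem[OF Pb x] .
      fix i assume i: "i \<in> {1..n}"
        and e: "component n M i (P (P x)) = ?P i (component n M i (P x))"
      have "?P i = zero_op (M i)" using const[OF i] True by simp
      then show "component n M i (P x) = 0"
        using e PP[OF x] component_mem[OF i Px] by (simp add: zero_op_def)
    qed
    then show ?thesis using bounded_ops_eq_zero_op[OF Pb] by blast
  next
    case False
    \<comment> \<open>The vector \<open>x - P x\<close> is killed by \<open>P\<close>, whose diagonal is the identity.\<close>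
    have "x - P x = 0" if x: "x \<in> H" for x
    proof (rule vanish)
      have Px: "P x \<in> H" using bounded_ops_mem[OF Pb x] .
      show d: "x - P x \<in> H" using complex_vs.subspace_diff[OF subspace x Px] .
      fix i assume i: "i \<in> {1..n}"
        and e: "component n M i (P (x - P x)) = ?P i (component n M i (x - P x))"
      have "P (x - P x) = 0" using bounded_ops_diff[OF Pb subspace x Px] PP[OF x] by simp
      moreover have "?P i = id_op (M i)" using const[OF i] dich[OF i] False by blast
      moreover have "component n M i 0 = 0"
        using component_diff[OF i x x] by simp
      ultimately show "component n M i (x - P x) = 0"
        using e component_mem[OF i d] by (simp add: id_op_def)
    qed
    then have "P = id_op H"
      by (intro extensionalityI[OF bounded_ops_ext[OF Pb]]) (simp_all add: id_op_def)
    then show ?thesis ..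
  qed
qed

end


section \<open>Flags with intertwiners of dense range in both directions\<close>

locale dense_intertwining = M: flag n \<A> H M T + N: flag_H n \<A> K N S
  for n :: nat and \<A> :: "('h::complex_hilbert set \<times> ('h \<Rightarrow> 'h)) set"
    and H M T K N S +
  fixes X Y :: "'h \<Rightarrow> 'h"
  assumes X: "X \<in> intertwiners H T K S" "dense_range H K X"
    and Y: "Y \<in> intertwiners K S H T" "dense_range K H Y"
begin

sublocale X: flag_intertwiner n \<A> H M T K N S X
  by unfold_locales (fact X)

sublocale Y: flag_intertwiner n \<A> K N S H M T Y
  by unfold_locales (fact Y)

text \<open>
  The last coordinate does not vanish on the whole space, so it cannot vanish on a dense
  subspace.
\<close>

lemma last_component_nonzero:
  assumes "decomposition n L P" "\<exists>x\<in>P n. x \<noteq> 0" "Z ` G \<subseteq> L" "dense_range G L Z"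
  shows "\<exists>x\<in>G. component n P n (Z x) \<noteq> 0"
proof (rule ccontr)
  interpret P: decomposition n L P by fact
  assume *: "\<not> ?thesis"
  have n: "n \<in> {1..n}" using M.n by auto
  obtain y where y: "y \<in> P n" "y \<noteq> 0" using assms(2) by blast
  then have yL: "y \<in> L" using P.summand(2)[OF n] by blast
  have "restrict (component n P n) L y = 0"
    by (rule zero_on_dense_range[OF P.component_bounded_ops[OF n] P.subspace assms(3,4) _ yL])
      (use * assms(3) in auto)
  then show False using P.component_summand[OF n n y(1)] y(2) yL by simp
qed

lemma XY: "compose K X Y \<in> intertwiners K S K S"
  using compose_intertwiners[OF N.subspace N.op Y(1) X(1)] .

lemma XY_last_component: "\<exists>x\<in>K. component n N n (compose K X Y x) \<noteq> 0"
proof (rule ccontr)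
  assume *: "\<not> ?thesis"
  have n: "n \<in> {1..n}" using M.n by auto
  have Z: "(\<lambda>x\<in>H. restrict (component n N n) K (X x)) \<in> bounded_ops H (N n)"
    by (rule restrict_compose_bounded_ops[OF M.subspace order_refl X.bounded
          N.component_bounded_ops[OF n]])
  have m: "Y ` K \<subseteq> H" "X ` H \<subseteq> K"
    using bounded_ops_mem[OF X.bounded] bounded_ops_mem[OF Y.bounded] by auto
  have "(\<lambda>x\<in>H. restrict (component n N n) K (X x)) x = 0" if "x \<in> H" for x
    by (rule zero_on_dense_range[OF Z M.subspace m(1) Y(2) _ that])
      (use * m in \<open>auto simp: compose_eq\<close>)
  then have "component n N n (X x) = 0" if "x \<in> H" for x
    using that bounded_ops_mem[OF X.bounded that] by fastforce
  then show False
    using last_component_nonzero[OF N.decomposition_axioms N.summand_nonzero[OF n] m(2) X(2)]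
    by blast
qed

text \<open>
  \<open>X Y\<close> commutes with \<open>S\<close> and has dense range, so its last component is not identically zero
  and \<open>commutant_diag_nonzero\<close> applies.
\<close>

lemma product_diagonal:
  assumes i: "i \<in> {1..n}"
  shows "\<exists>x\<in>N i. component n N i (X (Y x)) \<noteq> 0"
proof -
  obtain x where "x \<in> K" "component n N n (compose K X Y x) \<noteq> 0"
    using XY_last_component by blast
  from N.commutant_diag_nonzero[OF XY this i]
  have "block n N N (compose K X Y) i i \<noteq> zero_op (N i)" .
  moreover have "block n N N (compose K X Y) i i \<in> bounded_ops (N i) (N i)"
    using XY block_bounded_ops[OF N.decomposition_axioms N.decomposition_axioms _ i i]
    by (simp add: intertwiners_def)
  ultimately obtain x where x: "x \<in> N i" "block n N N (compose K X Y) i i x \<noteq> 0"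
    using bounded_ops_eq_zero_op by blast
  moreover have "x \<in> K" using N.summand(2)[OF i] x(1) by blast
  ultimately show ?thesis by (auto simp: block_def compose_eq)
qed

text \<open>
  Since the rows of \<open>Y\<close> below \<open>i\<close> are upper triangular, \<open>(X Y)\<^sub>i\<^sub>i\<close> is the sum of the products
  \<open>X\<^sub>i\<^sub>k Y\<^sub>k\<^sub>i\<close> with \<open>k \<le> i\<close>. As it is nonzero, so is some entry of row \<open>i\<close> of \<open>X\<close> on or before the
  diagonal.
\<close>

lemma intertwined_left:
  assumes i: "i \<in> {1..n}"
    and X_rows: "\<And>a. a \<in> {i<..n} \<Longrightarrow> upper_row n M N X a"
    and Y_rows: "\<And>a. a \<in> {i<..n} \<Longrightarrow> upper_row n N M Y a"
  shows "intertwined (M i) (M.diag i) (N i) (N.diag i)"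
proof -
  obtain x where x: "x \<in> N i" "component n N i (X (Y x)) \<noteq> 0"
    using product_diagonal[OF i] by blast
  then have "(\<Sum>k\<in>{1..i}. block n M N X i k (block n N M Y k i x)) \<noteq> 0"
    using block_compose_upper[OF N.decomposition_axioms M.decomposition_axioms
        N.decomposition_axioms Y.bounded X.bounded i x(1) Y_rows] by simp
  then obtain k where k: "k \<in> {1..i}" "block n M N X i k (block n N M Y k i x) \<noteq> 0"
    by (meson sum.neutral)
  have kn: "k \<in> {1..n}" using k(1) i by auto
  have "block n M N X i k \<noteq> zero_op (M k)"
    using k(2) bounded_ops_mem[OF Y.B_bounded[OF kn i] x(1)] by (auto simp: zero_op_def)
  then show ?thesis using X.intertwined_of_nonzero_entry[OF i k(1) _ X_rows] by blast
qed

text \<open>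
  Property (H) is known for the consecutive pair \<open>(S\<^sub>k, S\<^sub>k\<^sub>+\<^sub>1)\<close>. It is moved to \<open>(S\<^sub>i, R\<^sub>j\<^sub>+\<^sub>1)\<close>
  along \<open>S\<^sub>i \<leadsto> S\<^sub>k\<close> and \<open>S\<^sub>k\<^sub>+\<^sub>1 \<leadsto> R\<^sub>i \<leadsto> R\<^sub>j\<^sub>+\<^sub>1\<close> to treat \<open>X\<close>, and to \<open>(R\<^sub>i, S\<^sub>j\<^sub>+\<^sub>1)\<close> along
  \<open>R\<^sub>i \<leadsto> S\<^sub>i \<leadsto> S\<^sub>k\<close> and \<open>S\<^sub>k\<^sub>+\<^sub>1 \<leadsto> S\<^sub>j\<^sub>+\<^sub>1\<close> to treat \<open>Y\<close>. The index \<open>k\<close> is \<open>i\<close> for \<open>i < n\<close>, and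
  \<open>n - 1\<close> for the last row, which has no successor.
\<close>

lemma upper_rows_step:
  assumes i: "i \<in> {1..n}"
    and X_rows: "\<And>a. a \<in> {i<..n} \<Longrightarrow> upper_row n M N X a"
    and Y_rows: "\<And>a. a \<in> {i<..n} \<Longrightarrow> upper_row n N M Y a"
    and k: "k \<in> {1..<n}" "k \<le> i" "i \<le> Suc k"
    and return: "intertwined (N (Suc k)) (N.diag (Suc k)) (M i) (M.diag i)"
  shows "upper_row n M N X i" and "upper_row n N M Y i"
proof -
  have kn: "k \<in> {1..n}" "Suc k \<in> {1..n}" using k by auto
  note tr = property_H_transfer[OF M.\<A> N.diag_class[OF kn(1)] N.diag_class[OF kn(2)] _ _
      N.property_H[OF k(1)]]
  have ik: "intertwined (N i) (N.diag i) (N k) (N.diag k)"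
    using N.diag_intertwined[of k i] k i by auto
  show "upper_row n M N X i"
  proof (rule X.upper_row_step[OF i X_rows])
    fix j assume j: "j \<in> {1..<i}"
    then have sj: "Suc j \<in> {1..n}" using i by auto
    have "intertwined (M i) (M.diag i) (M (Suc j)) (M.diag (Suc j))"
      using M.diag_intertwined[of "Suc j" i] i j by auto
    then have "intertwined (N (Suc k)) (N.diag (Suc k)) (M (Suc j)) (M.diag (Suc j))"
      using intertwined_trans[OF M.\<A> N.diag_class[OF kn(2)] M.diag_class[OF i]
          M.diag_class[OF sj] return] by blast
    then show "property_H (N i) (N.diag i) (M (Suc j)) (M.diag (Suc j))"
      by (rule tr[OF N.diag_class[OF i] M.diag_class[OF sj] ik])
  qed
  show "upper_row n N M Y i"
  proof (rule Y.upper_row_step[OF i Y_rows])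
    fix j assume j: "j \<in> {1..<i}"
    then have sj: "Suc j \<in> {1..n}" using i by auto
    have "intertwined (N (Suc k)) (N.diag (Suc k)) (N (Suc j)) (N.diag (Suc j))"
      using N.diag_intertwined[of "Suc j" "Suc k"] kn j k by auto
    moreover have "intertwined (M i) (M.diag i) (N k) (N.diag k)"
      using intertwined_trans[OF M.\<A> M.diag_class[OF i] N.diag_class[OF i]
          N.diag_class[OF kn(1)] intertwined_left[OF i X_rows Y_rows] ik] by blast
    ultimately show "property_H (M i) (M.diag i) (N (Suc j)) (N.diag (Suc j))"
      using tr[OF M.diag_class[OF i] N.diag_class[OF sj]] by blast
  qed
qed

text \<open>
  All four claims are proved together, from the last row upwards: the step for the rows needs
  the intertwiners of the following index, and the intertwiners need the following rows.
\<close>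

lemma upper_and_intertwined:
  assumes "i \<in> {1..n}"
  shows "upper_row n M N X i \<and> upper_row n N M Y i \<and>
    intertwined (M i) (M.diag i) (N i) (N.diag i) \<and>
    intertwined (N i) (N.diag i) (M i) (M.diag i)"
  using assms
proof (induction rule: downward_induct)
  case (step i)
  have X_rows: "\<And>a. a \<in> {i<..n} \<Longrightarrow> upper_row n M N X a"
    and Y_rows: "\<And>a. a \<in> {i<..n} \<Longrightarrow> upper_row n N M Y a"
    using step(2) by blast+
  note i = step(1)
  have MN: "intertwined (M i) (M.diag i) (N i) (N.diag i)"
    using intertwined_left[OF i X_rows Y_rows] .
  have "\<exists>k\<in>{1..<n}. k \<le> i \<and> i \<le> Suc k \<and>
      intertwined (N (Suc k)) (N.diag (Suc k)) (M i) (M.diag i)"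
  proof (cases "i = n")
    case True
    \<comment> \<open>There is no following index; the dense range of \<open>Y\<close> makes its last row nonzero.\<close>
    have "Y ` K \<subseteq> H" using bounded_ops_mem[OF Y.bounded] by auto
    then obtain x where "x \<in> K" "component n M n (Y x) \<noteq> 0"
      using last_component_nonzero[OF M.decomposition_axioms M.summand_nonzero _ Y(2)] i True
      by auto
    then obtain k where "k \<in> {1..n}" "block n N M Y n k \<noteq> zero_op (N k)"
      using Y.nonzero_entry[of n x] i True by auto
    then have "intertwined (N n) (N.diag n) (M n) (M.diag n)"
      using Y.intertwined_of_nonzero_entry[of n k] i True by auto
    moreover have "n - 1 \<in> {1..<n}" "Suc (n - 1) = n" using M.n by auto
    ultimately show ?thesis using True by (intro bexI[of _ "n - 1"]) auto
  next
    case False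
    then have i': "i \<in> {1..<n}" and si: "Suc i \<in> {1..n}" using i by auto
    have "intertwined (N (Suc i)) (N.diag (Suc i)) (M (Suc i)) (M.diag (Suc i))"
      using step(2)[of "Suc i"] i' by auto
    moreover have "intertwined (M (Suc i)) (M.diag (Suc i)) (M i) (M.diag i)"
      using M.diag_intertwined[of i "Suc i"] i' by auto
    ultimately have "intertwined (N (Suc i)) (N.diag (Suc i)) (M i) (M.diag i)"
      using intertwined_trans[OF M.\<A> N.diag_class[OF si] M.diag_class[OF si]
          M.diag_class[OF i]] by blast
    then show ?thesis using i' by auto
  qed
  then obtain k where k: "k \<in> {1..<n}" "k \<le> i" "i \<le> Suc k"
    "intertwined (N (Suc k)) (N.diag (Suc k)) (M i) (M.diag i)" by blast
  note rows = upper_rows_step[OF i X_rows Y_rows k]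
  \<comment> \<open>Now \<open>X\<^sub>i\<^sub>i Y\<^sub>i\<^sub>i = (X Y)\<^sub>i\<^sub>i\<close> is nonzero, hence so is \<open>Y\<^sub>i\<^sub>i\<close>.\<close>
  obtain x where x: "x \<in> N i" "component n N i (X (Y x)) \<noteq> 0"
    using product_diagonal[OF i] by blast
  then have "block n M N X i i (block n N M Y i i x) \<noteq> 0"
    using block_compose_diagonal[OF N.decomposition_axioms M.decomposition_axioms
        N.decomposition_axioms Y.bounded X.bounded i x(1) Y_rows rows(1)] by simp
  then have "block n N M Y i i \<noteq> zero_op (N i)"
    using x(1) X.B_zero[OF i i] by (auto simp: zero_op_def)
  then have "intertwined (N i) (N.diag i) (M i) (M.diag i)"
    using Y.intertwined_of_nonzero_entry[OF i, of i] i Y_rows by auto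
  then show ?case using rows MN by blast
qed

text \<open>
  Property (H) for \<open>(S\<^sub>i, S\<^sub>i\<^sub>+\<^sub>1)\<close> moves to \<open>(R\<^sub>i, R\<^sub>i\<^sub>+\<^sub>1)\<close> along \<open>R\<^sub>i \<leadsto> S\<^sub>i\<close> and
  \<open>S\<^sub>i\<^sub>+\<^sub>1 \<leadsto> R\<^sub>i\<^sub>+\<^sub>1\<close>.
\<close>

lemma flag_H_left: "flag_H n \<A> H M T"
proof unfold_locales
  fix i assume i: "i \<in> {1..<n}"
  then have i': "i \<in> {1..n}" "Suc i \<in> {1..n}" by auto
  show "property_H (M i) (M.diag i) (M (Suc i)) (M.diag (Suc i))"
    using property_H_transfer[OF M.\<A> N.diag_class[OF i'(1)] N.diag_class[OF i'(2)]
        M.diag_class[OF i'(1)] M.diag_class[OF i'(2)] N.property_H[OF i]]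
      upper_and_intertwined[OF i'(1)] upper_and_intertwined[OF i'(2)] by blast
qed

end

theorem theorem5p5:
  fixes n :: nat
    and \<A> :: "('h::complex_hilbert set \<times> ('h \<Rightarrow> 'h)) set"
    and H H' :: "'h set"
    and M M' :: "nat \<Rightarrow> 'h set"
    and T T' :: "'h \<Rightarrow> 'h"
  assumes "n \<ge> 2"
    and "dense_range_class \<A>"
    and "flag_class n \<A> H M T"
    and "flag_class n \<A> H' M' T'"
    and "\<And>i. i \<in> {1..n} \<Longrightarrow> strongly_irreducible (M i) (op_entry n M T i i)"
    and "\<And>i. i \<in> {1..n} \<Longrightarrow> strongly_irreducible (M' i) (op_entry n M' T' i i)"
    and "\<And>i. i \<in> {1..n} \<Longrightarrow> cring (commutant (M i) (op_entry n M T i i)) \<and>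
           semisimple_ring (commutant (M i) (op_entry n M T i i))"
    and "\<And>i. i \<in> {1..n} \<Longrightarrow> cring (commutant (M' i) (op_entry n M' T' i i)) \<and>
           semisimple_ring (commutant (M' i) (op_entry n M' T' i i))"
    and "\<And>i. i \<in> {1..n-1} \<Longrightarrow>
           property_H (M' i) (op_entry n M' T' i i) (M' (i+1)) (op_entry n M' T' (i+1) (i+1))"
    and "quasi_similar H T H' T'"
  shows "strongly_irreducible H T"
proof -
  obtain X Y where XY: "quasi_affine H H' X" "quasi_affine H' H Y"
    "compose H X T = compose H T' X" "compose H' T Y = compose H' Y T'"
    using assms(10) unfolding quasi_similar_def by blast
  interpret flags: dense_intertwining n \<A> H M T H' M' T' X Y
  proof unfold_locales
    show "property_H (M' i) (block n M' M' T' i i) (M' (Suc i)) (block n M' M' T' (Suc i) (Suc i))"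
      if "i \<in> {1..<n}" for i
      using assms(9)[of i] that by (auto simp: op_entry_eq_block)
    show "X \<in> intertwiners H T H' T'" "dense_range H H' X"
      "Y \<in> intertwiners H' T' H T" "dense_range H' H Y"
      using XY by (simp_all add: quasi_affine_def intertwiners_iff)
  qed (use assms(1-4) in auto)
  show ?thesis
    using flag_H.strongly_irreducible_flag[OF flags.flag_H_left] assms(5)
    by (simp add: op_entry_eq_block)
qed

end
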